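(* Let $X$ be a pointed metric space, $E$ a Banach space and $(B(X,E^* ),\|\cdot\|_B)$ a Lipschitz operator Banach space. The following are equivalent: (i) There exists a dualizable Lipschitz cross-norm $\alpha$ on $X\boxtimes E$ such that $B(X,E^* )=\mathrm{Lip}_\alpha(X,E^* )$ and $\|f\|_B=\mathrm{Lip}_\alpha(f)$ for all $f\in B(X,E^* )$. (ii) There exists a dualizable Lipschitz cross-norm $\alpha$ on $X\boxtimes E$ such that $B(X,E^* )$ is canonically isometrically isomorphic to $(X\widehat{\boxtimes}_\alpha E)^*$, i.e. via the map sending $f$ to the functional determined by $\sum_{i=1}^n\delta_{(x_i,y_i)}\boxtimes e_i\mapsto\sum_{i=1}^n\langle f(x_i)-f(y_i),e_i\rangle$ on $X\boxtimes E$. (iii) The closed unit ball of $B(X,E^* )$ is compact in the weak* Lipschitz operator topology of $\mathrm{Lip}_0(X,E^* )$.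
   Context: $\mathbb{K}$ is $\mathbb R$ or $\mathbb C$. A pointed metric space $X$ is a metric space with metric $d$ and a designated base point $0$; a normed space is pointed by its zero vector. For a Banach space $F$, $\mathrm{Lip}_0(X,F)$ is the space of base-point preserving Lipschitz maps $X\to F$, with norm $\mathrm{Lip}$ (least Lipschitz constant); $X^\#=\mathrm{Lip}_0(X,\mathbb K)$; $E^*$ is the topological dual. The Lipschitz tensor product $X\boxtimes E$ is the linear span of all linear functionals $\delta_{(x,y)}\boxtimes e$ on $\mathrm{Lip}_0(X,E^* )$ of the form $(\delta_{(x,y)}\boxtimes e)(f)=\langle f(x)-f(y),e\rangle$, for $x,y\in X$ and $e\in E$. A norm $\alpha$ on $X\boxtimes E$ is a Lipschitz cross-norm if $\alpha(\delta_{(x,y)}\boxtimes e)=d(x,y)\|e\|$ always; $X\widehat\boxtimes_\alpha E$ is the completion of $(X\boxtimes E,\alpha)$. It is dualizable if $\left|\sum_{i=1}^n(g(x_i)-g(y_i))\langle\phi,e_i\rangle\right|\le\mathrm{Lip}(g)\|\phi\|\,\alpha\left(\sum_{i=1}^n\delta_{(x_i,y_i)}\boxtimes e_i\right)$ for all $g\in X^\#$, $\phi\in E^*$ and $\sum_i\delta_{(x_i,y_i)}\boxtimes e_i\in X\boxtimes E$. A base-point preserving map $f\colon X\to E^*$ is an $\alpha$-Lipschitz operator if there is $C\ge 0$ with $\left|\sum_{i=1}^n\langle f(x_i)-f(y_i),e_i\rangle\right|\le C\,\alpha\left(\sum_{i=1}^n\delta_{(x_i,y_i)}\boxtimes e_i\right)$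 for all $\sum_{i=1}^n\delta_{(x_i,y_i)}\boxtimes e_i\in X\boxtimes E$; the infimum of such $C$ is $\mathrm{Lip}_\alpha(f)$, and $\mathrm{Lip}_\alpha(X,E^* )$ is the set of all such maps. A Lipschitz operator Banach space from $X$ to $E^*$ is a linear subspace $B(X,E^* )$ of $\mathrm{Lip}_0(X,E^* )$ with a norm $\|\cdot\|_B$ such that: (1) $(B(X,E^* ),\|\cdot\|_B)$ is a Banach space; (2) $\|f\|_B\ge\mathrm{Lip}(f)$ for every $f\in B(X,E^* )$; (3) for every $g\in X^\#$ and $\phi\in E^*$, the map $g\cdot\phi\colon x\mapsto g(x)\phi$ belongs to $B(X,E^* )$ and $\|g\cdot\phi\|_B=\mathrm{Lip}(g)\|\phi\|$. The weak* Lipschitz operator topology on $\mathrm{Lip}_0(X,E^* )$ is the topology induced by the linear space $X\boxtimes E$ of linear functionals on it: $f_\gamma\to f$ iff $u(f_\gamma)\to u(f)$ for all $u\in X\boxtimes E$. *)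

theory Defs
  imports "HOL-Analysis.Analysis" "HOL-Library.Function_Algebras"
begin

section \<open>The scalar field\<close>

text \<open>
  The scalar field is the reals (take \<open>\<iota> = 0\<close>) or the complex numbers (\<open>\<iota>\<close> the imaginary unit),
  with the usual absolute value.
\<close>

class real_or_complex = real_normed_field +
  assumes real_or_complex:
    "\<exists>\<iota>. (\<forall>c. \<exists>a b. c = a *\<^sub>R 1 + b *\<^sub>R \<iota>) \<and>
         (\<iota> = 0 \<or>
          (\<iota> * \<iota> = - 1 \<and> (\<forall>a b. norm (a *\<^sub>R 1 + b *\<^sub>R \<iota>) = sqrt (a\<^sup>2 + b\<^sup>2))))"

instance real :: real_or_complex
proof
  have "\<forall>c::real. \<exists>a b. c = a *\<^sub>R 1 + b *\<^sub>R 0"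
    by simp
  then show "\<exists>\<iota>::real. (\<forall>c. \<exists>a b. c = a *\<^sub>R 1 + b *\<^sub>R \<iota>) \<and>
         (\<iota> = 0 \<or>
          (\<iota> * \<iota> = - 1 \<and> (\<forall>a b. norm (a *\<^sub>R 1 + b *\<^sub>R \<iota>) = sqrt (a\<^sup>2 + b\<^sup>2))))"
    by blast
qed

instance complex :: real_or_complex
proof
  have "\<exists>a b. c = a *\<^sub>R 1 + b *\<^sub>R \<i>" for c
    by (rule exI[of _ "Re c"], rule exI[of _ "Im c"]) (simp add: complex_eq_iff)
  moreover have "norm (a *\<^sub>R 1 + b *\<^sub>R \<i>) = sqrt (a\<^sup>2 + b\<^sup>2)" for a b
    by (simp add: cmod_def)
  ultimately show "\<exists>\<iota>::complex. (\<forall>c. \<exists>a b. c = a *\<^sub>R 1 + b *\<^sub>R \<iota>) \<and>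
         (\<iota> = 0 \<or>
          (\<iota> * \<iota> = - 1 \<and> (\<forall>a b. norm (a *\<^sub>R 1 + b *\<^sub>R \<iota>) = sqrt (a\<^sup>2 + b\<^sup>2))))"
    using i_squared by blast
qed


section \<open>Normed spaces over the scalar field\<close>

text \<open>
  A Banach space over the scalar field: a real Banach space carrying a scalar multiplication that
  extends \<open>(*\<^sub>R)\<close> and for which the norm is homogeneous.
\<close>

locale scalar_banach = vector_space sE
  for sE :: "'k::real_or_complex \<Rightarrow> 'e::banach \<Rightarrow> 'e" +
  assumes scale_of_real: "sE (of_real r) x = r *\<^sub>R x"
    and norm_scale: "norm (sE c x) = norm c * norm x"

text \<open>
  Norms, completeness and completions for subspaces \<open>V\<close> of a vector space with scalar
  multiplication \<open>s\<close>; the values of \<open>N\<close> outside \<open>V\<close> are irrelevant.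
\<close>

definition norm_on :: "('k::real_or_complex \<Rightarrow> 'v::ab_group_add \<Rightarrow> 'v) \<Rightarrow> 'v set \<Rightarrow> ('v \<Rightarrow> real) \<Rightarrow> bool" where
  "norm_on s V N \<longleftrightarrow>
     module.subspace s V \<and>
     (\<forall>v\<in>V. 0 \<le> N v) \<and>
     (\<forall>v\<in>V. N v = 0 \<longleftrightarrow> v = 0) \<and>
     (\<forall>c. \<forall>v\<in>V. N (s c v) = norm c * N v) \<and>
     (\<forall>v\<in>V. \<forall>w\<in>V. N (v + w) \<le> N v + N w)"

definition cauchy_seqs :: "'v::ab_group_add set \<Rightarrow> ('v \<Rightarrow> real) \<Rightarrow> (nat \<Rightarrow> 'v) set" where
  "cauchy_seqs V N =
     {\<sigma>. range \<sigma> \<subseteq> V \<and> (\<forall>\<epsilon>>0. \<exists>M. \<forall>m\<ge>M. \<forall>n\<ge>M. N (\<sigma> m - \<sigma> n) < \<epsilon>)}"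

definition complete_norm_on :: "'v::ab_group_add set \<Rightarrow> ('v \<Rightarrow> real) \<Rightarrow> bool" where
  "complete_norm_on V N \<longleftrightarrow>
     (\<forall>\<sigma>\<in>cauchy_seqs V N. \<exists>v\<in>V. (\<lambda>n. N (\<sigma> n - v)) \<longlonglongrightarrow> 0)"

text \<open>
  The completion: Cauchy sequences modulo null sequences. Operations on classes are written with
  unions over representatives, as is usual for quotients in HOL.
\<close>

definition null_rel :: "'v::ab_group_add set \<Rightarrow> ('v \<Rightarrow> real) \<Rightarrow> (nat \<Rightarrow> 'v) rel" where
  "null_rel V N =
     {(\<sigma>, \<tau>). \<sigma> \<in> cauchy_seqs V N \<and> \<tau> \<in> cauchy_seqs V N \<and> (\<lambda>n. N (\<sigma> n - \<tau> n)) \<longlonglongrightarrow> 0}"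

definition completion :: "'v::ab_group_add set \<Rightarrow> ('v \<Rightarrow> real) \<Rightarrow> (nat \<Rightarrow> 'v) set set" where
  "completion V N = cauchy_seqs V N // null_rel V N"

definition comp_embed :: "'v::ab_group_add set \<Rightarrow> ('v \<Rightarrow> real) \<Rightarrow> 'v \<Rightarrow> (nat \<Rightarrow> 'v) set" where
  "comp_embed V N v = null_rel V N `` {\<lambda>n. v}"

definition comp_add ::
    "'v::ab_group_add set \<Rightarrow> ('v \<Rightarrow> real) \<Rightarrow> (nat \<Rightarrow> 'v) set \<Rightarrow> (nat \<Rightarrow> 'v) set \<Rightarrow> (nat \<Rightarrow> 'v) set" where
  "comp_add V N A B = (\<Union>\<sigma>\<in>A. \<Union>\<tau>\<in>B. null_rel V N `` {\<lambda>n. \<sigma> n + \<tau> n})"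

definition comp_scale ::
    "('k::real_or_complex \<Rightarrow> 'v::ab_group_add \<Rightarrow> 'v) \<Rightarrow> 'v set \<Rightarrow> ('v \<Rightarrow> real) \<Rightarrow>
     'k \<Rightarrow> (nat \<Rightarrow> 'v) set \<Rightarrow> (nat \<Rightarrow> 'v) set" where
  "comp_scale s V N c A = (\<Union>\<sigma>\<in>A. null_rel V N `` {\<lambda>n. s c (\<sigma> n)})"

definition comp_norm :: "('v::ab_group_add \<Rightarrow> real) \<Rightarrow> (nat \<Rightarrow> 'v) set \<Rightarrow> real" where
  "comp_norm N A = the_elem ((\<lambda>\<sigma>. lim (\<lambda>n. N (\<sigma> n))) ` A)"

text \<open>
  Functionals on the completion are functions that vanish off the carrier, so that equal
  functionals are equal as functions.
\<close>

definition comp_dual ::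
    "('k::real_or_complex \<Rightarrow> 'v::ab_group_add \<Rightarrow> 'v) \<Rightarrow> 'v set \<Rightarrow> ('v \<Rightarrow> real) \<Rightarrow>
     ((nat \<Rightarrow> 'v) set \<Rightarrow> 'k) set" where
  "comp_dual s V N =
     {\<phi>. (\<forall>A. A \<notin> completion V N \<longrightarrow> \<phi> A = 0) \<and>
          (\<forall>A\<in>completion V N. \<forall>B\<in>completion V N. \<phi> (comp_add V N A B) = \<phi> A + \<phi> B) \<and>
          (\<forall>c. \<forall>A\<in>completion V N. \<phi> (comp_scale s V N c A) = c * \<phi> A) \<and>
          (\<exists>C. \<forall>A\<in>completion V N. norm (\<phi> A) \<le> C * comp_norm N A)}"

definition comp_dual_norm ::
    "'v::ab_group_add set \<Rightarrow> ('v \<Rightarrow> real) \<Rightarrow> ((nat \<Rightarrow> 'v) set \<Rightarrow> 'k::real_or_complex) \<Rightarrow> real" where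
  "comp_dual_norm V N \<phi> =
     Inf {C. 0 \<le> C \<and> (\<forall>A\<in>completion V N. norm (\<phi> A) \<le> C * comp_norm N A)}"


section \<open>Lipschitz operators\<close>

text \<open>
  The pointed metric space is a type \<open>'x\<close> with base point \<open>z\<close>. The dual of \<open>E\<close> consists of the
  bounded real-linear maps that are homogeneous over the scalar field; its norm is the operator
  norm of the type \<open>'e \<Rightarrow>\<^sub>L 'k\<close>.
\<close>

definition dualE :: "('k::real_or_complex \<Rightarrow> 'e::banach \<Rightarrow> 'e) \<Rightarrow> ('e \<Rightarrow>\<^sub>L 'k) set" where
  "dualE sE = {\<phi>. \<forall>c e. blinfun_apply \<phi> (sE c e) = c * blinfun_apply \<phi> e}"

definition scaleD :: "'k::real_or_complex \<Rightarrow> ('e::banach \<Rightarrow>\<^sub>L 'k) \<Rightarrow> ('e \<Rightarrow>\<^sub>L 'k)" where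
  "scaleD c \<phi> = blinfun_mult_right c o\<^sub>L \<phi>"

definition Lip :: "('x::metric_space \<Rightarrow> 'b::metric_space) \<Rightarrow> real" where
  "Lip f = Inf {L. L-lipschitz_on UNIV f}"

definition lip_dual :: "'x::metric_space \<Rightarrow> ('x \<Rightarrow> 'k::real_or_complex) set" where
  "lip_dual z = {g. g z = 0 \<and> (\<exists>L. L-lipschitz_on UNIV g)}"

definition Lip0 ::
    "('k::real_or_complex \<Rightarrow> 'e::banach \<Rightarrow> 'e) \<Rightarrow> 'x::metric_space \<Rightarrow> ('x \<Rightarrow> 'e \<Rightarrow>\<^sub>L 'k) set" where
  "Lip0 sE z = {f. f z = 0 \<and> range f \<subseteq> dualE sE \<and> (\<exists>L. L-lipschitz_on UNIV f)}"

definition scale_op :: "'k::real_or_complex \<Rightarrow> ('x \<Rightarrow> 'e::banach \<Rightarrow>\<^sub>L 'k) \<Rightarrow> ('x \<Rightarrow> 'e \<Rightarrow>\<^sub>L 'k)" where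
  "scale_op c f = (\<lambda>x. scaleD c (f x))"

definition lip_op_banach ::
    "('k::real_or_complex \<Rightarrow> 'e::banach \<Rightarrow> 'e) \<Rightarrow> 'x::metric_space \<Rightarrow>
     ('x \<Rightarrow> 'e \<Rightarrow>\<^sub>L 'k) set \<Rightarrow> (('x \<Rightarrow> 'e \<Rightarrow>\<^sub>L 'k) \<Rightarrow> real) \<Rightarrow> bool" where
  "lip_op_banach sE z B NB \<longleftrightarrow>
     B \<subseteq> Lip0 sE z \<and>
     norm_on scale_op B NB \<and> complete_norm_on B NB \<and>
     (\<forall>f\<in>B. Lip f \<le> NB f) \<and>
     (\<forall>g\<in>lip_dual z. \<forall>\<phi>\<in>dualE sE.
        (\<lambda>x. scaleD (g x) \<phi>) \<in> B \<and> NB (\<lambda>x. scaleD (g x) \<phi>) = Lip g * norm \<phi>)"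


section \<open>The Lipschitz tensor product\<close>

text \<open>
  Functionals on \<open>Lip0 sE z\<close> are functions vanishing off \<open>Lip0 sE z\<close>, with pointwise operations.
\<close>

definition scale_fun :: "'k::real_or_complex \<Rightarrow> ('f \<Rightarrow> 'k) \<Rightarrow> ('f \<Rightarrow> 'k)" where
  "scale_fun c u = (\<lambda>f. c * u f)"

definition elt ::
    "('k::real_or_complex \<Rightarrow> 'e::banach \<Rightarrow> 'e) \<Rightarrow> 'x::metric_space \<Rightarrow>
     'x \<Rightarrow> 'x \<Rightarrow> 'e \<Rightarrow> ('x \<Rightarrow> 'e \<Rightarrow>\<^sub>L 'k) \<Rightarrow> 'k" where
  "elt sE z x y e = (\<lambda>f. if f \<in> Lip0 sE z then blinfun_apply (f x - f y) e else 0)"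

definition lip_tensor ::
    "('k::real_or_complex \<Rightarrow> 'e::banach \<Rightarrow> 'e) \<Rightarrow> 'x::metric_space \<Rightarrow>
     (('x \<Rightarrow> 'e \<Rightarrow>\<^sub>L 'k) \<Rightarrow> 'k) set" where
  "lip_tensor sE z = module.span scale_fun {elt sE z x y e | x y e. True}"

lemma vector_space_scale_op: "vector_space scale_op"
  by standard
    (rule ext, rule blinfun_eqI, simp add: scale_op_def scaleD_def blinfun.add_left
      distrib_left distrib_right mult.assoc)+

lemma vector_space_scale_fun: "vector_space scale_fun"
  by standard (simp_all add: scale_fun_def fun_eq_iff distrib_left distrib_right mult.assoc)

definition lip_cross_norm ::
    "('k::real_or_complex \<Rightarrow> 'e::banach \<Rightarrow> 'e) \<Rightarrow> 'x::metric_space \<Rightarrow>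
     ((('x \<Rightarrow> 'e \<Rightarrow>\<^sub>L 'k) \<Rightarrow> 'k) \<Rightarrow> real) \<Rightarrow> bool" where
  "lip_cross_norm sE z \<alpha> \<longleftrightarrow>
     norm_on scale_fun (lip_tensor sE z) \<alpha> \<and>
     (\<forall>x y e. \<alpha> (elt sE z x y e) = dist x y * norm e)"

definition dualizable ::
    "('k::real_or_complex \<Rightarrow> 'e::banach \<Rightarrow> 'e) \<Rightarrow> 'x::metric_space \<Rightarrow>
     ((('x \<Rightarrow> 'e \<Rightarrow>\<^sub>L 'k) \<Rightarrow> 'k) \<Rightarrow> real) \<Rightarrow> bool" where
  "dualizable sE z \<alpha> \<longleftrightarrow>
     (\<forall>g\<in>lip_dual z. \<forall>\<phi>\<in>dualE sE. \<forall>(n::nat) x y e.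
        norm (\<Sum>i<n. (g (x i) - g (y i)) * blinfun_apply \<phi> (e i))
          \<le> Lip g * norm \<phi> * \<alpha> (\<Sum>i<n. elt sE z (x i) (y i) (e i)))"

definition alpha_bound ::
    "('k::real_or_complex \<Rightarrow> 'e::banach \<Rightarrow> 'e) \<Rightarrow> 'x::metric_space \<Rightarrow>
     ((('x \<Rightarrow> 'e \<Rightarrow>\<^sub>L 'k) \<Rightarrow> 'k) \<Rightarrow> real) \<Rightarrow> ('x \<Rightarrow> 'e \<Rightarrow>\<^sub>L 'k) \<Rightarrow> real \<Rightarrow> bool" where
  "alpha_bound sE z \<alpha> f C \<longleftrightarrow>
     0 \<le> C \<and>
     (\<forall>(n::nat) x y e.
        norm (\<Sum>i<n. blinfun_apply (f (x i) - f (y i)) (e i))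
          \<le> C * \<alpha> (\<Sum>i<n. elt sE z (x i) (y i) (e i)))"

definition Lip_alpha_space ::
    "('k::real_or_complex \<Rightarrow> 'e::banach \<Rightarrow> 'e) \<Rightarrow> 'x::metric_space \<Rightarrow>
     ((('x \<Rightarrow> 'e \<Rightarrow>\<^sub>L 'k) \<Rightarrow> 'k) \<Rightarrow> real) \<Rightarrow> ('x \<Rightarrow> 'e \<Rightarrow>\<^sub>L 'k) set" where
  "Lip_alpha_space sE z \<alpha> =
     {f. f z = 0 \<and> range f \<subseteq> dualE sE \<and> (\<exists>C. alpha_bound sE z \<alpha> f C)}"

definition Lip_alpha ::
    "('k::real_or_complex \<Rightarrow> 'e::banach \<Rightarrow> 'e) \<Rightarrow> 'x::metric_space \<Rightarrow>
     ((('x \<Rightarrow> 'e \<Rightarrow>\<^sub>L 'k) \<Rightarrow> 'k) \<Rightarrow> real) \<Rightarrow> ('x \<Rightarrow> 'e \<Rightarrow>\<^sub>L 'k) \<Rightarrow> real" where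
  "Lip_alpha sE z \<alpha> f = Inf {C. alpha_bound sE z \<alpha> f C}"

definition canonical_iso ::
    "('k::real_or_complex \<Rightarrow> 'e::banach \<Rightarrow> 'e) \<Rightarrow> 'x::metric_space \<Rightarrow>
     ((('x \<Rightarrow> 'e \<Rightarrow>\<^sub>L 'k) \<Rightarrow> 'k) \<Rightarrow> real) \<Rightarrow>
     ('x \<Rightarrow> 'e \<Rightarrow>\<^sub>L 'k) set \<Rightarrow> (('x \<Rightarrow> 'e \<Rightarrow>\<^sub>L 'k) \<Rightarrow> real) \<Rightarrow>
     (('x \<Rightarrow> 'e \<Rightarrow>\<^sub>L 'k) \<Rightarrow> (nat \<Rightarrow> ('x \<Rightarrow> 'e \<Rightarrow>\<^sub>L 'k) \<Rightarrow> 'k) set \<Rightarrow> 'k) \<Rightarrow> bool" where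
  "canonical_iso sE z \<alpha> B NB J \<longleftrightarrow>
     bij_betw J B (comp_dual scale_fun (lip_tensor sE z) \<alpha>) \<and>
     (\<forall>f\<in>B. \<forall>g\<in>B. J (f + g) = J f + J g) \<and>
     (\<forall>c. \<forall>f\<in>B. J (scale_op c f) = scale_fun c (J f)) \<and>
     (\<forall>f\<in>B. comp_dual_norm (lip_tensor sE z) \<alpha> (J f) = NB f) \<and>
     (\<forall>f\<in>B. \<forall>(n::nat) x y e.
        J f (comp_embed (lip_tensor sE z) \<alpha> (\<Sum>i<n. elt sE z (x i) (y i) (e i)))
          = (\<Sum>i<n. blinfun_apply (f (x i) - f (y i)) (e i)))"

definition weak_star_lip_topology ::
    "('k::real_or_complex \<Rightarrow> 'e::banach \<Rightarrow> 'e) \<Rightarrow> 'x::metric_space \<Rightarrow>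
     ('x \<Rightarrow> 'e \<Rightarrow>\<^sub>L 'k) topology" where
  "weak_star_lip_topology sE z =
     topology_generated_by {{f \<in> Lip0 sE z. u f \<in> U} | u U. u \<in> lip_tensor sE z \<and> open U}"

end

theory Submission
  imports Defs
begin

text \<open>
  A functional on the tensor product that is bounded for a Lipschitz cross-norm \<open>\<alpha>\<close> is evaluation
  at exactly one operator \<open>f\<close>, namely the one whose value \<open>f x\<close> is obtained by feeding
  \<open>\<delta>\<^bsub>(x,0)\<^esub> \<boxtimes> e\<close> to the functional; the cross-norm identity makes \<open>f\<close> Lipschitz
  (\<open>functional_is_evaluation\<close>). The constants admissible for \<open>f\<close> as an \<open>\<alpha>\<close>-Lipschitz operator are
  the bounds of that functional, and bounded functionals extend uniquely to the completion with the
  same bounds. So, for each fixed \<open>\<alpha>\<close>, the space \<open>Lip\<^sub>\<alpha>\<close> is canonically the dual of the completion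
  (\<open>canonical_iso_Lip_alpha\<close>), and a canonical isometry determines the space it starts from
  (\<open>canonical_iso_determines\<close>). Hence the two conditions
  are equivalent for each \<open>\<alpha>\<close> separately.

  If \<open>B\<close> is \<open>Lip\<^sub>\<alpha>\<close> isometrically, then the unit ball of \<open>B\<close> is the polar
  \<open>{f. \<bar>u f\<bar> \<le> \<alpha> u for all u}\<close>, and Tychonoff's theorem applies as in the proof of
  Banach--Alaoglu (\<open>compactin_polar\<close>).

  Conversely, let the unit ball \<open>K\<close> of \<open>B\<close> be compact and put \<open>\<alpha> u = sup {\<bar>u f\<bar>. f \<in> K}\<close>. This is
  finite because \<open>Lip f \<le> \<parallel>f\<parallel>\<^sub>B\<close>. Since \<open>B\<close> contains the rank-one operators \<open>g \<cdot> \<phi>\<close> with the product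
  of the norms as norm, testing on them shows that \<open>\<alpha>\<close> is dualizable, and, with the functionals
  \<open>\<phi>\<close> provided by the Hahn--Banach theorem, that \<open>\<alpha>\<close> is definite and a cross-norm. It
  remains to see that every \<open>f\<close> in the polar of \<open>\<alpha>\<close> lies in \<open>K\<close>: this is a bipolar theorem
  (\<open>bipolar\<close>). A point outside the compact set \<open>K\<close> is distinguished from every point of \<open>K\<close> by one of
  finitely many functionals, so that separating it from \<open>K\<close> is a question about a compact convex set in
  a finite-dimensional Euclidean space, settled by a nearest point (\<open>weak_star_separation\<close>).
\<close>

section \<open>The scalar field\<close>

text \<open>
  Real and complex scalars are treated uniformly: over the reals \<open>\<iota> = 0\<close>, so that formulas written
  with the real part \<open>re\<close> and with \<open>\<iota>\<close> reduce to their real counterparts.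
\<close>

lemma scalar_decomposition:
  "\<exists>(re :: 'k::real_or_complex \<Rightarrow> real) \<iota>. linear re \<and> (\<forall>c. \<bar>re c\<bar> \<le> norm c) \<and>
     (\<forall>a b. re (a *\<^sub>R 1 + b *\<^sub>R \<iota>) = a) \<and>
     (\<forall>c. \<exists>b. \<bar>b\<bar> \<le> norm c \<and> c = re c *\<^sub>R 1 + b *\<^sub>R \<iota>) \<and> (\<iota> = 0 \<or> \<iota> * \<iota> = - 1)"
proof -
  obtain \<iota> :: 'k where ex: "\<And>c. \<exists>a b. c = a *\<^sub>R 1 + b *\<^sub>R \<iota>"
    and alt: "\<iota> = 0 \<or> (\<iota> * \<iota> = - 1 \<and> (\<forall>a b. norm (a *\<^sub>R 1 + b *\<^sub>R \<iota>) = sqrt (a\<^sup>2 + b\<^sup>2)))"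
    using real_or_complex by blast
  have norm_a: "\<bar>a\<bar> \<le> norm (a *\<^sub>R 1 + b *\<^sub>R \<iota>)" for a b
    using alt by (auto simp: real_le_rsqrt)
  define re where "re c = (SOME a. \<exists>b. c = a *\<^sub>R 1 + b *\<^sub>R \<iota>)" for c
  have re: "re (a *\<^sub>R 1 + b *\<^sub>R \<iota>) = a" for a b
  proof -
    have "\<exists>a' b'. a *\<^sub>R 1 + b *\<^sub>R \<iota> = a' *\<^sub>R 1 + b' *\<^sub>R \<iota>" by blast
    then obtain b' where "a *\<^sub>R 1 + b *\<^sub>R \<iota> = re (a *\<^sub>R 1 + b *\<^sub>R \<iota>) *\<^sub>R 1 + b' *\<^sub>R \<iota>"
      unfolding re_def by (metis (mono_tags, lifting) someI_ex)
    then have "(a - re (a *\<^sub>R 1 + b *\<^sub>R \<iota>)) *\<^sub>R 1 + (b - b') *\<^sub>R \<iota> = 0"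
      by (simp add: algebra_simps)
    then show ?thesis
      using norm_a[of "a - re (a *\<^sub>R 1 + b *\<^sub>R \<iota>)" "b - b'"] by simp
  qed
  have lin: "linear re"
  proof
    fix c d :: 'k and r :: real
    obtain a b where c: "c = a *\<^sub>R 1 + b *\<^sub>R \<iota>" using ex by blast
    obtain a' b' where d: "d = a' *\<^sub>R 1 + b' *\<^sub>R \<iota>" using ex by blast
    have "c + d = (a + a') *\<^sub>R 1 + (b + b') *\<^sub>R \<iota>" "r *\<^sub>R c = (r * a) *\<^sub>R 1 + (r * b) *\<^sub>R \<iota>"
      by (simp_all add: c d algebra_simps)
    then show "re (c + d) = re c + re d" "re (r *\<^sub>R c) = r *\<^sub>R re c"
      by (simp_all only: re c d real_scaleR_def)
  qed
  have le: "\<bar>re c\<bar> \<le> norm c" for c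
    using ex[of c] re norm_a by auto
  have im: "\<exists>b. \<bar>b\<bar> \<le> norm c \<and> c = re c *\<^sub>R 1 + b *\<^sub>R \<iota>" for c
  proof -
    obtain a b where c: "c = a *\<^sub>R 1 + b *\<^sub>R \<iota>" using ex by blast
    show ?thesis
    proof (cases "\<iota> = 0")
      case True
      then have "c = re c *\<^sub>R 1" using c re[of a 0] by simp
      with True show ?thesis by (intro exI[of _ 0]) simp
    next
      case False
      with alt have "\<bar>b\<bar> \<le> norm c" by (auto simp: c real_le_rsqrt)
      then show ?thesis using c re[of a b] by auto
    qed
  qed
  show ?thesis using lin le re im alt by blast
qed

text \<open>
  The ball lies in the continuous image of a square of real coordinates. Compactness of scalar
  balls is needed for Tychonoff's theorem below, and it also yields completeness of the field.
\<close>

lemma compact_scalar_cball: "compact (cball (0::'k::real_or_complex) r)"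
proof -
  obtain \<iota> :: 'k and re where re: "\<And>c. \<bar>re c\<bar> \<le> norm c"
    and im: "\<And>c. \<exists>b. \<bar>b\<bar> \<le> norm c \<and> c = re c *\<^sub>R 1 + b *\<^sub>R \<iota>"
    using scalar_decomposition[where 'k = 'k] by metis
  define Q where "Q = (\<lambda>(a, b). a *\<^sub>R 1 + b *\<^sub>R \<iota>) ` ({-r..r} \<times> {-r..r})"
  have "compact Q"
    unfolding Q_def by (intro compact_continuous_image compact_Times compact_Icc)
      (auto simp: case_prod_unfold intro!: continuous_intros)
  moreover have "cball 0 r \<subseteq> Q"
  proof
    fix c :: 'k assume "c \<in> cball 0 r"
    then have "norm c \<le> r" by simp
    moreover obtain b where "\<bar>b\<bar> \<le> norm c" "c = re c *\<^sub>R 1 + b *\<^sub>R \<iota>" using im by blast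
    ultimately show "c \<in> Q"
      unfolding Q_def using re[of c] by (intro image_eqI[of _ _ "(re c, b)"]) auto
  qed
  ultimately show ?thesis
    using compact_Int_closed[of Q "cball 0 r"] by (simp add: Int_absorb1)
qed

lemma scalar_Cauchy_convergent:
  fixes X :: "nat \<Rightarrow> 'k::real_or_complex"
  assumes "Cauchy X"
  shows "convergent X"
proof -
  obtain r where "\<And>n. norm (X n) \<le> r"
    using cauchy_imp_bounded[OF assms] by (auto simp: bounded_iff)
  then have "\<forall>n. X n \<in> cball 0 r" by simp
  moreover have "complete (cball (0::'k) r)"
    by (rule compact_imp_complete[OF compact_scalar_cball])
  ultimately show ?thesis
    using assms unfolding complete_def convergent_def by blast
qed

lemma unimodular_multiple:
  fixes c :: "'k::real_or_complex"
  obtains a where "norm a = 1" "a * c = of_real (norm c)"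
proof (cases "c = 0")
  case True
  then show thesis using that[of 1] by simp
next
  case False
  then show thesis using that[of "of_real (norm c) / c"] by (simp add: norm_divide)
qed

section \<open>Norming functionals and the Hahn--Banach theorem\<close>

text \<open>
  Norming functionals are found as minimal elements among sublinear functions below the norm; this
  replaces the usual extension from subspaces, because a minimal sublinear function is linear.
\<close>

definition sublinear :: "('a::real_vector \<Rightarrow> real) \<Rightarrow> bool" where
  "sublinear q \<longleftrightarrow> (\<forall>x y. q (x + y) \<le> q x + q y) \<and> (\<forall>t\<ge>0. \<forall>x. q (t *\<^sub>R x) = t * q x)"

lemma sublinear_add: "sublinear q \<Longrightarrow> q (x + y) \<le> q x + q y"
  by (simp add: sublinear_def)

lemma sublinear_scale: "sublinear q \<Longrightarrow> 0 \<le> t \<Longrightarrow> q (t *\<^sub>R x) = t * q x"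
  by (simp add: sublinear_def)

lemma sublinear_zero: "sublinear q \<Longrightarrow> q 0 = 0"
  using sublinear_scale[of q 0 0] by simp

lemma sublinear_lower: "sublinear q \<Longrightarrow> - q (- x) \<le> q x"
  using sublinear_add[of q x "- x"] by (simp add: sublinear_zero)

lemma sublinearI:
  assumes add: "\<And>x y. q (x + y) \<le> q x + q y" and zero: "q 0 = 0"
    and scale: "\<And>t x. 0 < t \<Longrightarrow> q (t *\<^sub>R x) \<le> t * q x"
  shows "sublinear q"
  unfolding sublinear_def
proof (intro conjI allI impI)
  fix t :: real and x assume "0 \<le> t"
  show "q (t *\<^sub>R x) = t * q x"
  proof (cases "t = 0")
    case False
    with \<open>0 \<le> t\<close> have t: "0 < t" by simp
    then have "q x \<le> inverse t * q (t *\<^sub>R x)"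
      using scale[of "inverse t" "t *\<^sub>R x"] by simp
    then have "t * q x \<le> q (t *\<^sub>R x)" using t by (simp add: field_simps)
    then show ?thesis using scale[OF t, of x] by simp
  qed (simp add: zero)
qed (rule add)

text \<open>
  For sublinear \<open>q\<close>, the largest sublinear function that lies below \<open>q\<close> and takes a value at most
  \<open>- q y\<close> at \<open>- y\<close>. It serves twice: to show that minimal functions are additive, and to force a
  prescribed value at one point before minimising.
\<close>

definition tilt :: "('a::real_vector \<Rightarrow> real) \<Rightarrow> 'a \<Rightarrow> 'a \<Rightarrow> real" where
  "tilt q y x = (INF t\<in>{0..}. q (x + t *\<^sub>R y) - t * q y)"

context
  fixes q :: "'a::real_vector \<Rightarrow> real"
  assumes q: "sublinear q"
begin

lemma tilt_le: "0 \<le> t \<Longrightarrow> tilt q y x \<le> q (x + t *\<^sub>R y) - t * q y"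
proof -
  have "- q (- x) \<le> q (x + t *\<^sub>R y) - t * q y" if "0 \<le> t" for t
    using sublinear_add[OF q, of "x + t *\<^sub>R y" "- x"] sublinear_scale[OF q that, of y] by simp
  then have "bdd_below ((\<lambda>t. q (x + t *\<^sub>R y) - t * q y) ` {0..})"
    by (intro bdd_belowI2[of _ "- q (- x)"]) auto
  then show "0 \<le> t \<Longrightarrow> ?thesis"
    unfolding tilt_def by (intro cINF_lower) auto
qed

lemma tilt_greatest: "(\<And>t. 0 \<le> t \<Longrightarrow> m \<le> q (x + t *\<^sub>R y) - t * q y) \<Longrightarrow> m \<le> tilt q y x"
  unfolding tilt_def by (intro cINF_greatest) auto

lemma sublinear_tilt: "sublinear (tilt q y)"
proof (rule sublinearI)
  fix x x'
  have *: "tilt q y (x + x') - (q (x + t *\<^sub>R y) - t * q y) \<le> q (x' + t' *\<^sub>R y) - t' * q y"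
    if "0 \<le> t" "0 \<le> t'" for t t'
    using tilt_le[of "t + t'" y "x + x'"] that sublinear_add[OF q, of "x + t *\<^sub>R y" "x' + t' *\<^sub>R y"]
    by (simp add: algebra_simps)
  have "tilt q y (x + x') - (q (x + t *\<^sub>R y) - t * q y) \<le> tilt q y x'" if "0 \<le> t" for t
    by (rule tilt_greatest) (rule *[OF that])
  then have "tilt q y (x + x') - tilt q y x' \<le> q (x + t *\<^sub>R y) - t * q y" if "0 \<le> t" for t
    using that by (force simp: algebra_simps)
  then have "tilt q y (x + x') - tilt q y x' \<le> tilt q y x" by (rule tilt_greatest)
  then show "tilt q y (x + x') \<le> tilt q y x + tilt q y x'" by simp
next
  have "0 \<le> tilt q y 0"
    by (rule tilt_greatest) (simp add: sublinear_scale[OF q])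
  then show "tilt q y 0 = 0"
    using tilt_le[of 0 y 0] by (simp add: sublinear_zero[OF q])
next
  fix s :: real and x assume s: "0 < s"
  have "tilt q y (s *\<^sub>R x) / s \<le> tilt q y x"
  proof (rule tilt_greatest)
    fix t :: real assume "0 \<le> t"
    then have "tilt q y (s *\<^sub>R x) \<le> q (s *\<^sub>R (x + t *\<^sub>R y)) - s * t * q y"
      using tilt_le[of "s * t" y "s *\<^sub>R x"] s by (simp add: algebra_simps)
    also have "\<dots> = s * (q (x + t *\<^sub>R y) - t * q y)"
      using sublinear_scale[OF q, of s "x + t *\<^sub>R y"] s by (simp add: right_diff_distrib)
    finally show "tilt q y (s *\<^sub>R x) / s \<le> q (x + t *\<^sub>R y) - t * q y"
      using s by (simp add: field_simps)
  qed
  then show "tilt q y (s *\<^sub>R x) \<le> s * tilt q y x" using s by (simp add: field_simps)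
qed

end

text \<open>
  For subadditivity of the infimum, two members of the chain are estimated by the smaller of them;
  finiteness comes from the common lower bound \<open>- q0 (- x)\<close>.
\<close>

lemma sublinear_INF_chain:
  fixes C :: "('a::real_vector \<Rightarrow> real) set"
  assumes "C \<noteq> {}" and sub: "\<And>q. q \<in> C \<Longrightarrow> sublinear q \<and> q \<le> q0"
    and chain: "\<And>q r. q \<in> C \<Longrightarrow> r \<in> C \<Longrightarrow> q \<le> r \<or> r \<le> q"
  shows "sublinear (\<lambda>x. INF q\<in>C. q x)" "\<And>q x. q \<in> C \<Longrightarrow> (INF q\<in>C. q x) \<le> q x"
proof -
  have lower: "- q0 (- x) \<le> q x" if "q \<in> C" for q x
    using sub[OF that] sublinear_lower[of q x] le_funD[of q q0 "- x"] by linarith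
  have bdd: "bdd_below ((\<lambda>q. q x) ` C)" for x
    by (rule bdd_belowI2[of _ "- q0 (- x)"]) (rule lower)
  show le: "(INF q\<in>C. q x) \<le> q x" if "q \<in> C" for q x
    by (rule cINF_lower[OF bdd that])
  have greatest: "m \<le> (INF q\<in>C. q x)" if "\<And>q. q \<in> C \<Longrightarrow> m \<le> q x" for m x
    using \<open>C \<noteq> {}\<close> that by (rule cINF_greatest)
  let ?i = "\<lambda>x. INF q\<in>C. q x"
  show "sublinear ?i"
  proof (rule sublinearI)
    fix x y
    have *: "?i (x + y) \<le> q x + r y" if qr: "q \<in> C" "r \<in> C" for q r
    proof -
      obtain p where p: "p \<in> C" "p \<le> q" "p \<le> r"
        using chain[OF qr] qr by blast
      have "?i (x + y) \<le> p (x + y)" by (rule le[OF p(1)])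
      also have "\<dots> \<le> p x + p y" using sub[OF p(1)] by (simp add: sublinear_add)
      also have "\<dots> \<le> q x + r y" using p(2,3) by (simp add: le_fun_def add_mono)
      finally show ?thesis .
    qed
    have "?i (x + y) - q x \<le> ?i y" if "q \<in> C" for q
      by (rule greatest) (use *[OF that] in \<open>simp add: algebra_simps\<close>)
    then have "?i (x + y) - ?i y \<le> ?i x"
      by (intro greatest) (simp add: algebra_simps)
    then show "?i (x + y) \<le> ?i x + ?i y" by simp
  next
    show "?i 0 = 0"
      using \<open>C \<noteq> {}\<close> sub by (simp add: sublinear_zero cong: INF_cong)
  next
    fix t :: real and x assume t: "0 < t"
    have "?i (t *\<^sub>R x) / t \<le> ?i x"
    proof (rule greatest)
      fix q assume q: "q \<in> C"
      then have "?i (t *\<^sub>R x) \<le> t * q x"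
        using le[OF q, of "t *\<^sub>R x"] sub[OF q] t by (simp add: sublinear_scale)
      then show "?i (t *\<^sub>R x) / t \<le> q x" using t by (simp add: field_simps)
    qed
    then show "?i (t *\<^sub>R x) \<le> t * ?i x" using t by (simp add: field_simps)
  qed
qed

text \<open>
  Minimality gives \<open>tilt q y = q\<close>, and the parameter \<open>t = 1\<close> in the infimum defining \<open>tilt\<close> then
  reads \<open>q x \<le> q (x + y) - q y\<close>, the converse of subadditivity.
\<close>

lemma minimal_sublinear_linear:
  assumes q: "sublinear q" and min: "\<And>r. sublinear r \<Longrightarrow> r \<le> q \<Longrightarrow> r = q"
  shows "linear q"
proof -
  have tilt: "tilt q y = q" for y
  proof (rule min[OF sublinear_tilt[OF q]])
    show "tilt q y \<le> q" using tilt_le[OF q, of 0 y] by (simp add: le_fun_def)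
  qed
  have add: "q (x + y) = q x + q y" for x y
    using tilt_le[OF q, of 1 y x] sublinear_add[OF q, of x y] by (simp add: tilt)
  have neg: "q (- x) = - q x" for x
    using add[of x "- x"] by (simp add: sublinear_zero[OF q])
  have "q (t *\<^sub>R x) = t * q x" for t x
    using sublinear_scale[OF q, of t x] sublinear_scale[OF q, of "- t" x] neg[of "t *\<^sub>R x"]
    by (cases "0 \<le> t") auto
  then show ?thesis by (intro linearI) (simp_all add: add)
qed

lemma linear_below_sublinear:
  fixes q0 :: "'a::real_vector \<Rightarrow> real"
  assumes q0: "sublinear q0"
  obtains p where "linear p" "p \<le> q0"
proof -
  define Q where "Q = {q. sublinear q \<and> q \<le> q0}"
  have "\<exists>m\<in>Q. \<forall>q\<in>Q. q \<le> m \<longrightarrow> q = m"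
  proof (rule predicate_Zorn)
    show "partial_order_on Q (relation_of (\<lambda>q r. r \<le> q) Q)"
      by (rule partial_order_on_relation_ofI) auto
    fix C assume C: "C \<in> Chains (relation_of (\<lambda>q r. r \<le> q) Q)"
    then have CQ: "C \<subseteq> Q" and chain: "\<And>q r. q \<in> C \<Longrightarrow> r \<in> C \<Longrightarrow> q \<le> r \<or> r \<le> q"
      by (auto simp: Chains_def relation_of_def)
    show "\<exists>u\<in>Q. \<forall>q\<in>C. u \<le> q"
    proof (cases "C = {}")
      case True
      then show ?thesis using q0 by (auto simp: Q_def)
    next
      case False
      have sub: "sublinear q \<and> q \<le> q0" if "q \<in> C" for q
        using that CQ by (auto simp: Q_def)
      let ?i = "\<lambda>x. INF q\<in>C. q x"
      have le: "?i \<le> q" if "q \<in> C" for q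
        using sublinear_INF_chain(2)[OF False sub chain that] by (simp add: le_fun_def)
      obtain c where "c \<in> C" using False by blast
      then have "?i \<le> q0" using le sub order_trans by blast
      then have "?i \<in> Q"
        using sublinear_INF_chain(1)[OF False sub chain] by (simp add: Q_def)
      then show ?thesis using le by blast
    qed
  qed
  then obtain m where m: "sublinear m" "m \<le> q0" and min: "\<forall>q\<in>Q. q \<le> m \<longrightarrow> q = m"
    by (auto simp: Q_def)
  have "linear m"
    using m(1)
  proof (rule minimal_sublinear_linear)
    fix r assume "sublinear r" "r \<le> m"
    then show "r = m" using min m(2) by (auto simp: Q_def intro: order_trans)
  qed
  then show thesis using that m(2) by blast
qed

text \<open>
  Any linear function below \<open>tilt norm e\<close> is below the norm and is at most \<open>- norm e\<close> at \<open>- e\<close>,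
  which forces its value at \<open>e\<close>.
\<close>

lemma real_norming_functional:
  fixes e :: "'a::real_normed_vector"
  obtains p :: "'a \<Rightarrow> real" where "linear p" "\<And>x. \<bar>p x\<bar> \<le> norm x" "p e = norm e"
proof -
  have norm: "sublinear (norm :: 'a \<Rightarrow> real)"
    by (simp add: sublinear_def norm_triangle_ineq)
  obtain p where p: "linear p" "p \<le> tilt norm e"
    using linear_below_sublinear[OF sublinear_tilt[OF norm]] .
  have le: "p x \<le> norm x" for x
    using le_funD[OF p(2), of x] tilt_le[OF norm, of 0 e x] by simp
  have "p (- e) \<le> - norm e"
    using le_funD[OF p(2), of "- e"] tilt_le[OF norm, of 1 e "- e"] by simp
  then have "p e = norm e"
    using le[of e] by (simp add: linear_neg[OF p(1)])
  moreover have "\<bar>p x\<bar> \<le> norm x" for x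
    using le[of x] le[of "- x"] by (simp add: linear_neg[OF p(1)] abs_le_iff)
  ultimately show thesis using that p(1) by blast
qed

text \<open>
  Bohnenblust and Sobczyk: a real functional \<open>p\<close> is the real part of the scalar-linear functional
  \<open>p x - p (\<iota> x) \<iota>\<close>, whose norm is that of \<open>p\<close>. For \<open>\<iota> = 0\<close> this is \<open>p\<close> itself.
\<close>

lemma norming_functional:
  assumes "scalar_banach sE"
  obtains \<phi> :: "'e::banach \<Rightarrow>\<^sub>L 'k::real_or_complex" where
    "\<phi> \<in> dualE sE" "norm \<phi> \<le> 1" "blinfun_apply \<phi> e = of_real (norm e)"
proof -
  interpret E: scalar_banach sE by fact
  obtain \<iota> :: 'k and re where lin_re: "linear re" and re: "\<And>c. \<bar>re c\<bar> \<le> norm c"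
    and re_eq: "\<And>a b. re (a *\<^sub>R 1 + b *\<^sub>R \<iota>) = a"
    and im: "\<And>c. \<exists>b. \<bar>b\<bar> \<le> norm c \<and> c = re c *\<^sub>R 1 + b *\<^sub>R \<iota>"
    and \<iota>: "\<iota> = 0 \<or> \<iota> * \<iota> = - 1"
    using scalar_decomposition[where 'k = 'k] by metis
  obtain p where p: "linear p" "\<And>x. \<bar>p x\<bar> \<le> norm x" "p e = norm e"
    using real_norming_functional[of e] by blast
  define h where "h x = p x *\<^sub>R 1 - p (sE \<iota> x) *\<^sub>R \<iota>" for x
  have re_h: "re (h x) = p x" for x
    using re_eq[of "p x" "- p (sE \<iota> x)"] by (simp add: h_def)
  have add: "h (x + y) = h x + h y" for x y
    by (simp add: h_def E.scale_right_distrib linear_add[OF p(1)] algebra_simps)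
  have sc: "sE (of_real r) x = r *\<^sub>R x" for r x by (rule E.scale_of_real)
  have \<iota>_real: "sE \<iota> (r *\<^sub>R x) = r *\<^sub>R sE \<iota> x" for r x
    by (simp add: sc[symmetric] mult.commute)
  have scaleR: "h (r *\<^sub>R x) = r *\<^sub>R h x" for r x
    by (simp add: h_def \<iota>_real linear_scale[OF p(1)] algebra_simps)
  have scale_\<iota>: "h (sE \<iota> x) = \<iota> * h x" for x
    using \<iota>
  proof
    assume "\<iota> = 0"
    then show ?thesis by (simp add: h_def linear_0[OF p(1)])
  next
    assume i: "\<iota> * \<iota> = - 1"
    then have "sE \<iota> (sE \<iota> x) = - x" by simp
    then show ?thesis using i
      by (simp add: h_def linear_neg[OF p(1)] algebra_simps)
  qed
  have scale: "h (sE c x) = c * h x" for c x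
  proof -
    obtain b where c: "c = re c *\<^sub>R 1 + b *\<^sub>R \<iota>" using im by blast
    have "sE c x = re c *\<^sub>R x + b *\<^sub>R sE \<iota> x"
    proof -
      have "sE c x = sE (of_real (re c) + of_real b * \<iota>) x"
        using c by (simp add: scaleR_conv_of_real)
      also have "\<dots> = re c *\<^sub>R x + b *\<^sub>R sE \<iota> x"
        by (simp only: E.scale_left_distrib E.scale_scale[symmetric] sc)
      finally show ?thesis .
    qed
    then have "h (sE c x) = (re c *\<^sub>R 1 + b *\<^sub>R \<iota>) * h x"
      by (simp add: add scaleR scale_\<iota> algebra_simps)
    then show ?thesis using c by simp
  qed
  have bound: "norm (h x) \<le> norm x" for x
  proof -
    obtain a where a: "norm a = 1" "a * h x = of_real (norm (h x))"
      using unimodular_multiple[of "h x"] by blast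
    have "re (a * h x) = norm (h x)"
      using re_eq[of "norm (h x)" 0] by (simp add: a(2) of_real_def)
    then have "norm (h x) = p (sE a x)"
      using re_h[of "sE a x"] by (simp add: scale)
    also have "\<dots> \<le> norm (sE a x)" using p(2) abs_le_D1 by blast
    finally show ?thesis by (simp add: E.norm_scale a(1))
  qed
  have bl: "bounded_linear h"
    by (rule bounded_linear_intro[of _ 1]) (simp_all add: add scaleR bound)
  \<comment> \<open>Only the real part of \<open>h e\<close> is known to be \<open>norm e\<close>; a rotation makes the value itself real.\<close>
  obtain a where a: "norm a = 1" "a * h e = of_real (norm (h e))"
    using unimodular_multiple[of "h e"] by blast
  have "norm e \<le> norm (h e)"
    using re[of "h e"] by (simp add: re_h p(3))
  then have he: "a * h e = of_real (norm e)"
    using bound[of e] by (simp add: a(2))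
  define \<phi> where "\<phi> = Blinfun (\<lambda>x. a * h x)"
  have \<phi>: "blinfun_apply \<phi> x = a * h x" for x
    unfolding \<phi>_def
    by (subst bounded_linear_Blinfun_apply[OF bounded_linear_const_mult[OF bl]]) (rule refl)
  show thesis
  proof (rule that)
    show "\<phi> \<in> dualE sE"
      by (simp add: dualE_def \<phi> scale)
    show "norm \<phi> \<le> 1"
      by (rule norm_blinfun_bound) (simp_all add: \<phi> norm_mult a(1) bound)
    show "blinfun_apply \<phi> e = of_real (norm e)"
      by (simp add: \<phi> he)
  qed
qed

section \<open>Functionals on a completion\<close>

text \<open>
  Continuous functionals on the completion correspond to bounded functionals on the dense
  subspace. The locale also serves as the source of elementary norm laws for the operator space
  \<open>B\<close>.
\<close>

locale normed_subspace = vector_space s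
  for s :: "'k::real_or_complex \<Rightarrow> 'v::ab_group_add \<Rightarrow> 'v" +
  fixes V :: "'v set" and N :: "'v \<Rightarrow> real"
  assumes norm_on: "norm_on s V N"
begin

lemma subspace_V: "subspace V"
  and N_nonneg: "v \<in> V \<Longrightarrow> 0 \<le> N v"
  and N_zero_iff: "v \<in> V \<Longrightarrow> N v = 0 \<longleftrightarrow> v = 0"
  and N_scale: "v \<in> V \<Longrightarrow> N (s c v) = norm c * N v"
  and N_add: "v \<in> V \<Longrightarrow> w \<in> V \<Longrightarrow> N (v + w) \<le> N v + N w"
  using norm_on by (simp_all add: norm_on_def)

lemma V_add: "v \<in> V \<Longrightarrow> w \<in> V \<Longrightarrow> v + w \<in> V"
  and V_diff: "v \<in> V \<Longrightarrow> w \<in> V \<Longrightarrow> v - w \<in> V"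
  and V_scale: "v \<in> V \<Longrightarrow> s c v \<in> V"
  and V_zero: "0 \<in> V"
  using subspace_V by (simp_all add: subspace_add subspace_diff subspace_scale subspace_0)

lemma N_zero: "N 0 = 0"
  using N_zero_iff[OF V_zero] by simp

lemma N_minus_commute: "v \<in> V \<Longrightarrow> w \<in> V \<Longrightarrow> N (v - w) = N (w - v)"
  using N_scale[of "w - v" "- 1"] by (simp add: V_diff)

lemma N_triangle: "u \<in> V \<Longrightarrow> v \<in> V \<Longrightarrow> w \<in> V \<Longrightarrow> N (u - w) \<le> N (u - v) + N (v - w)"
  using N_add[of "u - v" "v - w"] by (simp add: V_diff)

lemma N_reverse_triangle: "v \<in> V \<Longrightarrow> w \<in> V \<Longrightarrow> \<bar>N v - N w\<bar> \<le> N (v - w)"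
  using N_triangle[of v w 0] N_triangle[of w v 0] N_minus_commute[of v w]
  by (simp add: V_zero abs_le_iff)

abbreviation "cls \<sigma> \<equiv> null_rel V N `` {\<sigma>}"

lemma cauchy_seqs_in: "\<sigma> \<in> cauchy_seqs V N \<Longrightarrow> \<sigma> n \<in> V"
  by (auto simp: cauchy_seqs_def)

lemma cauchy_seqsD:
  "\<sigma> \<in> cauchy_seqs V N \<Longrightarrow> 0 < \<epsilon> \<Longrightarrow> \<exists>M. \<forall>m\<ge>M. \<forall>n\<ge>M. N (\<sigma> m - \<sigma> n) < \<epsilon>"
  by (simp add: cauchy_seqs_def)

lemma cauchy_seqs_const: "v \<in> V \<Longrightarrow> (\<lambda>n. v) \<in> cauchy_seqs V N"
  by (auto simp: cauchy_seqs_def N_zero)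

lemma cauchy_seqs_add:
  assumes \<sigma>: "\<sigma> \<in> cauchy_seqs V N" and \<tau>: "\<tau> \<in> cauchy_seqs V N"
  shows "(\<lambda>n. \<sigma> n + \<tau> n) \<in> cauchy_seqs V N"
proof -
  have "\<exists>M. \<forall>m\<ge>M. \<forall>n\<ge>M. N ((\<sigma> m + \<tau> m) - (\<sigma> n + \<tau> n)) < \<epsilon>" if \<epsilon>: "0 < \<epsilon>" for \<epsilon>
  proof -
    obtain M M' where M: "\<forall>m\<ge>M. \<forall>n\<ge>M. N (\<sigma> m - \<sigma> n) < \<epsilon> / 2"
      "\<forall>m\<ge>M'. \<forall>n\<ge>M'. N (\<tau> m - \<tau> n) < \<epsilon> / 2"
      using cauchy_seqsD[OF \<sigma> half_gt_zero[OF \<epsilon>]] cauchy_seqsD[OF \<tau> half_gt_zero[OF \<epsilon>]]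
      by blast
    have "N ((\<sigma> m + \<tau> m) - (\<sigma> n + \<tau> n)) < \<epsilon>" if "max M M' \<le> m" "max M M' \<le> n" for m n
    proof -
      have "N ((\<sigma> m + \<tau> m) - (\<sigma> n + \<tau> n)) \<le> N (\<sigma> m - \<sigma> n) + N (\<tau> m - \<tau> n)"
        using N_add[of "\<sigma> m - \<sigma> n" "\<tau> m - \<tau> n"]
        by (simp add: V_diff cauchy_seqs_in[OF \<sigma>] cauchy_seqs_in[OF \<tau>] algebra_simps)
      moreover have "N (\<sigma> m - \<sigma> n) < \<epsilon> / 2" "N (\<tau> m - \<tau> n) < \<epsilon> / 2"
        using M that by auto
      ultimately show ?thesis by linarith
    qed
    then show ?thesis by blast
  qed
  then show ?thesis
    by (auto simp: cauchy_seqs_def V_add cauchy_seqs_in[OF \<sigma>] cauchy_seqs_in[OF \<tau>])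
qed

lemma cauchy_seqs_scale:
  assumes \<sigma>: "\<sigma> \<in> cauchy_seqs V N"
  shows "(\<lambda>n. s c (\<sigma> n)) \<in> cauchy_seqs V N"
proof (cases "c = 0")
  case True
  then show ?thesis using cauchy_seqs_const[OF V_zero] by simp
next
  case False
  have N: "N (s c (\<sigma> m) - s c (\<sigma> n)) = norm c * N (\<sigma> m - \<sigma> n)" for m n
    using N_scale[of "\<sigma> m - \<sigma> n" c]
    by (simp add: V_diff cauchy_seqs_in[OF \<sigma>] scale_right_diff_distrib)
  have "\<exists>M. \<forall>m\<ge>M. \<forall>n\<ge>M. norm c * N (\<sigma> m - \<sigma> n) < \<epsilon>" if "0 < \<epsilon>" for \<epsilon>
    using cauchy_seqsD[OF \<sigma>, of "\<epsilon> / norm c"] that False by (simp add: field_simps)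
  then show ?thesis
    by (auto simp: cauchy_seqs_def V_scale cauchy_seqs_in[OF \<sigma>] N)
qed

lemma equiv_null_rel: "equiv (cauchy_seqs V N) (null_rel V N)"
proof (rule equivI)
  show "null_rel V N \<subseteq> cauchy_seqs V N \<times> cauchy_seqs V N"
    by (auto simp: null_rel_def)
  show "refl_on (cauchy_seqs V N) (null_rel V N)"
    by (auto simp: refl_on_def null_rel_def N_zero)
  show "sym (null_rel V N)"
    by (rule symI) (auto simp: null_rel_def N_minus_commute cauchy_seqs_in)
  show "trans (null_rel V N)"
  proof (rule transI)
    fix \<rho> \<sigma> \<tau> assume "(\<rho>, \<sigma>) \<in> null_rel V N" "(\<sigma>, \<tau>) \<in> null_rel V N"
    then have C: "\<rho> \<in> cauchy_seqs V N" "\<sigma> \<in> cauchy_seqs V N" "\<tau> \<in> cauchy_seqs V N"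
      and lim: "(\<lambda>n. N (\<rho> n - \<sigma> n)) \<longlonglongrightarrow> 0" "(\<lambda>n. N (\<sigma> n - \<tau> n)) \<longlonglongrightarrow> 0"
      by (auto simp: null_rel_def)
    note in_V = C[THEN cauchy_seqs_in]
    have "(\<lambda>n. N (\<rho> n - \<tau> n)) \<longlonglongrightarrow> 0"
    proof (rule tendsto_sandwich[of "\<lambda>_. 0"])
      show "(\<lambda>n. N (\<rho> n - \<sigma> n) + N (\<sigma> n - \<tau> n)) \<longlonglongrightarrow> 0"
        using tendsto_add[OF lim] by simp
    qed (simp_all add: N_nonneg N_triangle V_diff in_V)
    with C show "(\<rho>, \<tau>) \<in> null_rel V N" by (simp add: null_rel_def)
  qed
qed

lemma null_relD:
  assumes "(\<sigma>, \<tau>) \<in> null_rel V N"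
  shows "\<sigma> \<in> cauchy_seqs V N" "\<tau> \<in> cauchy_seqs V N" "(\<lambda>n. N (\<sigma> n - \<tau> n)) \<longlonglongrightarrow> 0"
  using assms by (auto simp: null_rel_def)

lemma cls_self: "\<sigma> \<in> cauchy_seqs V N \<Longrightarrow> \<sigma> \<in> cls \<sigma>"
  by (rule equiv_class_self[OF equiv_null_rel])

lemma cls_in_completion: "\<sigma> \<in> cauchy_seqs V N \<Longrightarrow> cls \<sigma> \<in> completion V N"
  unfolding completion_def by (rule quotientI)

lemma completionE:
  assumes "A \<in> completion V N"
  obtains \<sigma> where "\<sigma> \<in> cauchy_seqs V N" "A = cls \<sigma>"
  using assms unfolding completion_def by (rule quotientE)

lemma comp_add_cls:
  assumes \<sigma>: "\<sigma> \<in> cauchy_seqs V N" and \<tau>: "\<tau> \<in> cauchy_seqs V N"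
  shows "comp_add V N (cls \<sigma>) (cls \<tau>) = cls (\<lambda>n. \<sigma> n + \<tau> n)"
proof -
  have "cls (\<lambda>n. \<sigma>' n + \<tau>' n) = cls (\<lambda>n. \<sigma> n + \<tau> n)" if "\<sigma>' \<in> cls \<sigma>" "\<tau>' \<in> cls \<tau>" for \<sigma>' \<tau>'
  proof (rule equiv_class_eq[OF equiv_null_rel, symmetric])
    have 1: "(\<sigma>, \<sigma>') \<in> null_rel V N" and 2: "(\<tau>, \<tau>') \<in> null_rel V N" using that by auto
    note C = null_relD(1,2)[OF 1] null_relD(1,2)[OF 2]
    note in_V = C[THEN cauchy_seqs_in]
    have "(\<lambda>n. N ((\<sigma> n + \<tau> n) - (\<sigma>' n + \<tau>' n))) \<longlonglongrightarrow> 0"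
    proof (rule tendsto_sandwich[of "\<lambda>_. 0"])
      show "(\<lambda>n. N (\<sigma> n - \<sigma>' n) + N (\<tau> n - \<tau>' n)) \<longlonglongrightarrow> 0"
        using tendsto_add[OF null_relD(3)[OF 1] null_relD(3)[OF 2]] by simp
      show "\<forall>\<^sub>F n in sequentially.
          N ((\<sigma> n + \<tau> n) - (\<sigma>' n + \<tau>' n)) \<le> N (\<sigma> n - \<sigma>' n) + N (\<tau> n - \<tau>' n)"
      proof (intro always_eventually allI)
        fix n
        show "N ((\<sigma> n + \<tau> n) - (\<sigma>' n + \<tau>' n)) \<le> N (\<sigma> n - \<sigma>' n) + N (\<tau> n - \<tau>' n)"
          using N_add[of "\<sigma> n - \<sigma>' n" "\<tau> n - \<tau>' n"]
          by (simp add: V_diff in_V algebra_simps)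
      qed
    qed (simp_all add: N_nonneg V_add V_diff in_V)
    then show "(\<lambda>n. \<sigma> n + \<tau> n, \<lambda>n. \<sigma>' n + \<tau>' n) \<in> null_rel V N"
      using C by (simp add: null_rel_def cauchy_seqs_add)
  qed
  then show ?thesis
    using cls_self[OF \<sigma>] cls_self[OF \<tau>] unfolding comp_add_def by blast
qed

lemma comp_scale_cls:
  assumes \<sigma>: "\<sigma> \<in> cauchy_seqs V N"
  shows "comp_scale s V N c (cls \<sigma>) = cls (\<lambda>n. s c (\<sigma> n))"
proof -
  have "cls (\<lambda>n. s c (\<sigma>' n)) = cls (\<lambda>n. s c (\<sigma> n))" if "\<sigma>' \<in> cls \<sigma>" for \<sigma>'
  proof (rule equiv_class_eq[OF equiv_null_rel, symmetric])
    have 1: "(\<sigma>, \<sigma>') \<in> null_rel V N" using that by auto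
    note C = null_relD(1,2)[OF 1]
    note in_V = C[THEN cauchy_seqs_in]
    have "N (s c (\<sigma> n) - s c (\<sigma>' n)) = norm c * N (\<sigma> n - \<sigma>' n)" for n
      using N_scale[of "\<sigma> n - \<sigma>' n" c]
      by (simp add: V_diff in_V scale_right_diff_distrib)
    then have "(\<lambda>n. N (s c (\<sigma> n) - s c (\<sigma>' n))) \<longlonglongrightarrow> 0"
      using tendsto_mult_right_zero[OF null_relD(3)[OF 1]] by simp
    then show "(\<lambda>n. s c (\<sigma> n), \<lambda>n. s c (\<sigma>' n)) \<in> null_rel V N"
      using C by (simp add: null_rel_def cauchy_seqs_scale)
  qed
  then show ?thesis
    using cls_self[OF \<sigma>] unfolding comp_scale_def by blast
qed

text \<open>
  Applied both to the norm and to bounded functionals, this makes the choice of a representative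
  irrelevant.
\<close>

lemma lipschitz_along_cauchy:
  fixes h :: "'v \<Rightarrow> 'b::metric_space"
  assumes complete: "\<And>X :: nat \<Rightarrow> 'b. Cauchy X \<Longrightarrow> convergent X"
    and lip: "\<And>v w. v \<in> V \<Longrightarrow> w \<in> V \<Longrightarrow> dist (h v) (h w) \<le> C * N (v - w)"
    and \<sigma>: "\<sigma> \<in> cauchy_seqs V N"
  shows "\<exists>l. \<forall>\<tau>\<in>cls \<sigma>. (\<lambda>n. h (\<tau> n)) \<longlonglongrightarrow> l"
proof -
  have lip': "dist (h v) (h w) \<le> (\<bar>C\<bar> + 1) * N (v - w)" if "v \<in> V" "w \<in> V" for v w
  proof -
    have "C * N (v - w) \<le> (\<bar>C\<bar> + 1) * N (v - w)"
      by (rule mult_right_mono) (auto intro: N_nonneg V_diff that)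
    then show ?thesis using lip[OF that] by linarith
  qed
  have "Cauchy (\<lambda>n. h (\<sigma> n))"
  proof (rule metric_CauchyI)
    fix \<epsilon> :: real assume "0 < \<epsilon>"
    then have "0 < \<epsilon> / (\<bar>C\<bar> + 1)" by (simp add: add_nonneg_pos)
    then obtain M where M: "\<And>m n. m \<ge> M \<Longrightarrow> n \<ge> M \<Longrightarrow> N (\<sigma> m - \<sigma> n) < \<epsilon> / (\<bar>C\<bar> + 1)"
      using cauchy_seqsD[OF \<sigma>] by blast
    have "dist (h (\<sigma> m)) (h (\<sigma> n)) < \<epsilon>" if "m \<ge> M" "n \<ge> M" for m n
    proof -
      have "(\<bar>C\<bar> + 1) * N (\<sigma> m - \<sigma> n) < \<epsilon>"
        using M[OF that] by (simp add: pos_less_divide_eq add_nonneg_pos mult.commute)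
      then show ?thesis
        using lip'[OF cauchy_seqs_in[OF \<sigma>, of m] cauchy_seqs_in[OF \<sigma>, of n]] by linarith
    qed
    then show "\<exists>M. \<forall>m\<ge>M. \<forall>n\<ge>M. dist (h (\<sigma> m)) (h (\<sigma> n)) < \<epsilon>" by blast
  qed
  then obtain l where l: "(\<lambda>n. h (\<sigma> n)) \<longlonglongrightarrow> l"
    using complete unfolding convergent_def by blast
  have "(\<lambda>n. h (\<tau> n)) \<longlonglongrightarrow> l" if "\<tau> \<in> cls \<sigma>" for \<tau>
  proof -
    have rel: "(\<sigma>, \<tau>) \<in> null_rel V N" using that by simp
    have "(\<lambda>n. dist (h (\<sigma> n)) (h (\<tau> n))) \<longlonglongrightarrow> 0"
    proof (rule tendsto_sandwich[of "\<lambda>_. 0"])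
      show "(\<lambda>n. C * N (\<sigma> n - \<tau> n)) \<longlonglongrightarrow> 0"
        by (rule tendsto_mult_right_zero[OF null_relD(3)[OF rel]])
    qed (simp_all add: lip null_relD(1,2)[OF rel, THEN cauchy_seqs_in])
    then have "(\<lambda>n. dist (h (\<sigma> n)) (h (\<tau> n)) + dist (h (\<sigma> n)) l) \<longlonglongrightarrow> 0"
      using tendsto_add l[unfolded tendsto_dist_iff[of _ l]] by fastforce
    then have "(\<lambda>n. dist (h (\<tau> n)) l) \<longlonglongrightarrow> 0"
      by (intro Lim_null_comparison[of "\<lambda>n. dist (h (\<tau> n)) l"]) (simp_all add: dist_triangle3)
    then show ?thesis by (simp add: tendsto_dist_iff[of _ l])
  qed
  then show ?thesis by blast
qed

lemma comp_norm_cls: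
  assumes \<sigma>: "\<sigma> \<in> cauchy_seqs V N"
  shows "(\<lambda>n. N (\<sigma> n)) \<longlonglongrightarrow> comp_norm N (cls \<sigma>)"
proof -
  have "\<exists>l. \<forall>\<tau>\<in>cls \<sigma>. (\<lambda>n. N (\<tau> n)) \<longlonglongrightarrow> l"
    by (rule lipschitz_along_cauchy[of _ 1, OF _ _ \<sigma>])
      (auto simp: dist_real_def N_reverse_triangle Cauchy_convergent_iff)
  then obtain l where l: "\<forall>\<tau>\<in>cls \<sigma>. (\<lambda>n. N (\<tau> n)) \<longlonglongrightarrow> l" by blast
  then have "(\<lambda>\<tau>. lim (\<lambda>n. N (\<tau> n))) ` cls \<sigma> = {l}"
    using cls_self[OF \<sigma>] by (force simp: limI)
  then have "comp_norm N (cls \<sigma>) = l" by (simp add: comp_norm_def)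
  then show ?thesis using l cls_self[OF \<sigma>] by simp
qed

lemma comp_embed_cls: "comp_embed V N v = cls (\<lambda>n. v)"
  by (simp add: comp_embed_def)

lemma comp_embed_in: "v \<in> V \<Longrightarrow> comp_embed V N v \<in> completion V N"
  by (simp add: comp_embed_cls cls_in_completion cauchy_seqs_const)

lemma comp_norm_embed: "v \<in> V \<Longrightarrow> comp_norm N (comp_embed V N v) = N v"
  using comp_norm_cls[OF cauchy_seqs_const, of v] LIMSEQ_unique tendsto_const
  unfolding comp_embed_cls by blast

lemma comp_norm_nonneg: "A \<in> completion V N \<Longrightarrow> 0 \<le> comp_norm N A"
  using N_nonneg cauchy_seqs_in by (elim completionE) (metis LIMSEQ_le_const[OF comp_norm_cls])

definition linear_functional :: "('v \<Rightarrow> 'k) \<Rightarrow> bool" where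
  "linear_functional \<psi> \<longleftrightarrow>
     (\<forall>v\<in>V. \<forall>w\<in>V. \<psi> (v + w) = \<psi> v + \<psi> w) \<and> (\<forall>c. \<forall>v\<in>V. \<psi> (s c v) = c * \<psi> v)"

definition bounded_by :: "('v \<Rightarrow> 'k) \<Rightarrow> real \<Rightarrow> bool" where
  "bounded_by \<psi> C \<longleftrightarrow> (\<forall>v\<in>V. norm (\<psi> v) \<le> C * N v)"

text \<open>
  The representative is chosen arbitrarily. For a bounded functional the limit is the same along
  every representative, so this is its continuous extension to the completion.
\<close>

definition extension :: "('v \<Rightarrow> 'k) \<Rightarrow> (nat \<Rightarrow> 'v) set \<Rightarrow> 'k" where
  "extension \<psi> A = (if A \<in> completion V N then lim (\<lambda>n. \<psi> ((SOME \<sigma>. \<sigma> \<in> A) n)) else 0)"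

lemma functional_diff:
  assumes "linear_functional \<psi>" "v \<in> V" "w \<in> V"
  shows "\<psi> (v - w) = \<psi> v - \<psi> w"
proof -
  have "\<psi> (v + s (- 1) w) = \<psi> v + (- 1) * \<psi> w"
    using assms V_scale unfolding linear_functional_def by metis
  then show ?thesis by simp
qed

lemma extension_cls:
  assumes \<psi>: "linear_functional \<psi>" and C: "bounded_by \<psi> C" and \<sigma>: "\<sigma> \<in> cauchy_seqs V N"
  shows "(\<lambda>n. \<psi> (\<sigma> n)) \<longlonglongrightarrow> extension \<psi> (cls \<sigma>)"
proof -
  have "\<exists>l. \<forall>\<tau>\<in>cls \<sigma>. (\<lambda>n. \<psi> (\<tau> n)) \<longlonglongrightarrow> l"
  proof (rule lipschitz_along_cauchy[OF scalar_Cauchy_convergent _ \<sigma>])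
    fix v w assume "v \<in> V" "w \<in> V"
    then show "dist (\<psi> v) (\<psi> w) \<le> C * N (v - w)"
      using C by (simp add: dist_norm bounded_by_def V_diff flip: functional_diff[OF \<psi>])
  qed
  then obtain l where l: "\<forall>\<tau>\<in>cls \<sigma>. (\<lambda>n. \<psi> (\<tau> n)) \<longlonglongrightarrow> l" by blast
  have "(SOME \<tau>. \<tau> \<in> cls \<sigma>) \<in> cls \<sigma>"
    using cls_self[OF \<sigma>] by (rule someI[of "\<lambda>\<tau>. \<tau> \<in> cls \<sigma>"])
  then have "extension \<psi> (cls \<sigma>) = l"
    using l by (simp only: extension_def cls_in_completion[OF \<sigma>] if_True limI)
  then show ?thesis using l cls_self[OF \<sigma>] by simp
qed

lemma extension_embed:
  assumes "linear_functional \<psi>" "bounded_by \<psi> C" "v \<in> V"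
  shows "extension \<psi> (comp_embed V N v) = \<psi> v"
  using extension_cls[OF assms(1,2) cauchy_seqs_const[OF assms(3)]] LIMSEQ_unique tendsto_const
  unfolding comp_embed_cls by blast

lemma extension_in_comp_dual:
  assumes \<psi>: "linear_functional \<psi>" and C: "bounded_by \<psi> C"
  shows "extension \<psi> \<in> comp_dual s V N"
proof -
  note ext = extension_cls[OF \<psi> C]
  have "extension \<psi> (comp_add V N A B) = extension \<psi> A + extension \<psi> B"
    if A: "A \<in> completion V N" and B: "B \<in> completion V N" for A B
  proof -
    obtain \<sigma> \<tau> where \<sigma>: "\<sigma> \<in> cauchy_seqs V N" "A = cls \<sigma>" and \<tau>: "\<tau> \<in> cauchy_seqs V N" "B = cls \<tau>"
      using completionE[OF A] completionE[OF B] by metis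
    have eq: "(\<lambda>n. \<psi> (\<sigma> n + \<tau> n)) = (\<lambda>n. \<psi> (\<sigma> n) + \<psi> (\<tau> n))"
      using \<psi> \<sigma>(1) \<tau>(1) cauchy_seqs_in unfolding linear_functional_def by blast
    have "(\<lambda>n. \<psi> (\<sigma> n + \<tau> n)) \<longlonglongrightarrow> extension \<psi> A + extension \<psi> B"
      unfolding eq \<sigma>(2) \<tau>(2) by (intro tendsto_add ext \<sigma> \<tau>)
    then show ?thesis
      using ext[OF cauchy_seqs_add[OF \<sigma>(1) \<tau>(1)]] LIMSEQ_unique
      unfolding \<sigma>(2) \<tau>(2) comp_add_cls[OF \<sigma>(1) \<tau>(1)] by blast
  qed
  moreover have "extension \<psi> (comp_scale s V N c A) = c * extension \<psi> A"
    if A: "A \<in> completion V N" for c A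
  proof -
    obtain \<sigma> where \<sigma>: "\<sigma> \<in> cauchy_seqs V N" "A = cls \<sigma>" using completionE[OF A] .
    have eq: "(\<lambda>n. \<psi> (s c (\<sigma> n))) = (\<lambda>n. c * \<psi> (\<sigma> n))"
      using \<psi> \<sigma>(1) cauchy_seqs_in unfolding linear_functional_def by blast
    have "(\<lambda>n. \<psi> (s c (\<sigma> n))) \<longlonglongrightarrow> c * extension \<psi> A"
      unfolding eq \<sigma>(2) by (intro tendsto_mult_left ext \<sigma>)
    then show ?thesis
      using ext[OF cauchy_seqs_scale[OF \<sigma>(1)]] LIMSEQ_unique
      unfolding \<sigma>(2) comp_scale_cls[OF \<sigma>(1)] by blast
  qed
  moreover have "norm (extension \<psi> A) \<le> C * comp_norm N A" if A: "A \<in> completion V N" for A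
  proof -
    obtain \<sigma> where \<sigma>: "\<sigma> \<in> cauchy_seqs V N" "A = cls \<sigma>" using completionE[OF A] .
    have "(\<lambda>n. norm (\<psi> (\<sigma> n))) \<longlonglongrightarrow> norm (extension \<psi> A)"
      "(\<lambda>n. C * N (\<sigma> n)) \<longlonglongrightarrow> C * comp_norm N A"
      unfolding \<sigma>(2) by (intro tendsto_norm tendsto_mult_left ext comp_norm_cls \<sigma>)+
    then show ?thesis
      using C cauchy_seqs_in[OF \<sigma>(1)] by (intro LIMSEQ_le) (auto simp: bounded_by_def)
  qed
  moreover have "extension \<psi> A = 0" if "A \<notin> completion V N" for A
    using that by (simp add: extension_def)
  ultimately show ?thesis
    unfolding comp_dual_def by blast
qed

lemma comp_dual_restrict:
  assumes \<phi>: "\<phi> \<in> comp_dual s V N"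
  shows "linear_functional (\<lambda>v. \<phi> (comp_embed V N v))"
  unfolding linear_functional_def
proof (intro conjI allI ballI)
  fix v w assume "v \<in> V" "w \<in> V"
  then have "comp_embed V N (v + w) = comp_add V N (comp_embed V N v) (comp_embed V N w)"
    using comp_add_cls[OF cauchy_seqs_const cauchy_seqs_const] by (simp add: comp_embed_cls)
  then show "\<phi> (comp_embed V N (v + w)) = \<phi> (comp_embed V N v) + \<phi> (comp_embed V N w)"
    using \<phi> \<open>v \<in> V\<close> \<open>w \<in> V\<close> comp_embed_in by (simp add: comp_dual_def)
next
  fix c v assume "v \<in> V"
  then have "comp_embed V N (s c v) = comp_scale s V N c (comp_embed V N v)"
    using comp_scale_cls[OF cauchy_seqs_const] by (simp add: comp_embed_cls)
  then show "\<phi> (comp_embed V N (s c v)) = c * \<phi> (comp_embed V N v)"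
    using \<phi> \<open>v \<in> V\<close> comp_embed_in by (simp add: comp_dual_def)
qed

text \<open>
  The class of a Cauchy sequence is the limit, in the completion, of the embedded terms of the
  sequence; hence a functional on the completion is determined by its values on the embedded
  space.
\<close>

lemma comp_dual_cls:
  assumes \<phi>: "\<phi> \<in> comp_dual s V N" and \<sigma>: "\<sigma> \<in> cauchy_seqs V N"
  shows "(\<lambda>m. \<phi> (comp_embed V N (\<sigma> m))) \<longlonglongrightarrow> \<phi> (cls \<sigma>)"
proof -
  obtain C0 where C0: "\<And>A. A \<in> completion V N \<Longrightarrow> norm (\<phi> A) \<le> C0 * comp_norm N A"
    using \<phi> unfolding comp_dual_def by blast
  define C where "C = \<bar>C0\<bar> + 1"
  have C: "norm (\<phi> A) \<le> C * comp_norm N A" if "A \<in> completion V N" for A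
  proof -
    have "C0 * comp_norm N A \<le> C * comp_norm N A"
      by (rule mult_right_mono) (auto simp: C_def comp_norm_nonneg[OF that])
    then show ?thesis using C0[OF that] by linarith
  qed
  have "0 < C" by (simp add: C_def add_nonneg_pos)
  show ?thesis
  proof (rule metric_LIMSEQ_I)
    fix \<epsilon> :: real assume "0 < \<epsilon>"
    then have "0 < \<epsilon> / (2 * C)" using \<open>0 < C\<close> by simp
    then obtain M where M: "\<And>m n. m \<ge> M \<Longrightarrow> n \<ge> M \<Longrightarrow> N (\<sigma> n - \<sigma> m) < \<epsilon> / (2 * C)"
      using cauchy_seqsD[OF \<sigma>] by blast
    have "dist (\<phi> (comp_embed V N (\<sigma> m))) (\<phi> (cls \<sigma>)) < \<epsilon>" if "m \<ge> M" for m
    proof -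
      note v = cauchy_seqs_in[OF \<sigma>, of m]
      \<comment> \<open>The constant sequence is written as a scalar multiple by \<open>- 1\<close>, so that the difference is formed
          with the addition and scaling of the completion.\<close>
      let ?\<kappa> = "\<lambda>n. s (- 1) (\<sigma> m)"
      note \<kappa> = cauchy_seqs_scale[OF cauchy_seqs_const[OF v], of "- 1"]
      have diff: "\<phi> (cls (\<lambda>n. \<sigma> n + ?\<kappa> n)) = \<phi> (cls \<sigma>) - \<phi> (comp_embed V N (\<sigma> m))"
      proof -
        have "\<phi> (cls (\<lambda>n. \<sigma> n + ?\<kappa> n)) = \<phi> (cls \<sigma>) + \<phi> (cls ?\<kappa>)"
          unfolding comp_add_cls[OF \<sigma> \<kappa>, symmetric]
          using \<phi> cls_in_completion[OF \<sigma>] cls_in_completion[OF \<kappa>] by (simp only: comp_dual_def mem_Collect_eq)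
        also have "\<phi> (cls ?\<kappa>) = - 1 * \<phi> (comp_embed V N (\<sigma> m))"
          unfolding comp_embed_cls comp_scale_cls[OF cauchy_seqs_const[OF v], symmetric]
          using \<phi> comp_embed_in[OF v, unfolded comp_embed_cls] by (simp only: comp_dual_def mem_Collect_eq)
        finally show ?thesis by simp
      qed
      have "comp_norm N (cls (\<lambda>n. \<sigma> n + ?\<kappa> n)) \<le> \<epsilon> / (2 * C)"
      proof (rule LIMSEQ_le_const2[OF comp_norm_cls[OF cauchy_seqs_add[OF \<sigma> \<kappa>]]])
        show "\<exists>M. \<forall>n\<ge>M. N (\<sigma> n + ?\<kappa> n) \<le> \<epsilon> / (2 * C)"
          using M[OF that] by (auto intro!: exI[of _ M] less_imp_le)
      qed
      then have "C * comp_norm N (cls (\<lambda>n. \<sigma> n + ?\<kappa> n)) \<le> \<epsilon> / 2"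
        using \<open>0 < C\<close> by (simp add: field_simps)
      then have "norm (\<phi> (cls \<sigma>) - \<phi> (comp_embed V N (\<sigma> m))) \<le> \<epsilon> / 2"
        unfolding diff[symmetric] using C[OF cls_in_completion[OF cauchy_seqs_add[OF \<sigma> \<kappa>]]] by linarith
      then show ?thesis
        using \<open>0 < \<epsilon>\<close> by (simp add: dist_norm norm_minus_commute)
    qed
    then show "\<exists>M. \<forall>m\<ge>M. dist (\<phi> (comp_embed V N (\<sigma> m))) (\<phi> (cls \<sigma>)) < \<epsilon>" by blast
  qed
qed

lemma comp_dual_eqI:
  assumes \<phi>: "\<phi> \<in> comp_dual s V N" and \<psi>: "\<psi> \<in> comp_dual s V N"
    and eq: "\<And>v. v \<in> V \<Longrightarrow> \<phi> (comp_embed V N v) = \<psi> (comp_embed V N v)"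
  shows "\<phi> = \<psi>"
proof
  fix A
  show "\<phi> A = \<psi> A"
  proof (cases "A \<in> completion V N")
    case True
    then obtain \<sigma> where \<sigma>: "\<sigma> \<in> cauchy_seqs V N" "A = cls \<sigma>" by (rule completionE)
    have "(\<lambda>m. \<phi> (comp_embed V N (\<sigma> m))) = (\<lambda>m. \<psi> (comp_embed V N (\<sigma> m)))"
      using eq cauchy_seqs_in[OF \<sigma>(1)] by blast
    then show ?thesis
      using comp_dual_cls[OF \<phi> \<sigma>(1)] comp_dual_cls[OF \<psi> \<sigma>(1)] LIMSEQ_unique \<sigma>(2) by metis
  next
    case False
    then show ?thesis using \<phi> \<psi> by (simp add: comp_dual_def)
  qed
qed

text \<open>
  Restriction to the dense subspace preserves every bound, hence the norm of the functional.
\<close>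

lemma comp_dual_bound_iff:
  assumes \<phi>: "\<phi> \<in> comp_dual s V N"
  shows "(\<forall>A\<in>completion V N. norm (\<phi> A) \<le> C * comp_norm N A)
     \<longleftrightarrow> bounded_by (\<lambda>v. \<phi> (comp_embed V N v)) C"
  unfolding bounded_by_def
proof (intro iffI ballI)
  fix v assume "\<forall>A\<in>completion V N. norm (\<phi> A) \<le> C * comp_norm N A" "v \<in> V"
  then show "norm (\<phi> (comp_embed V N v)) \<le> C * N v"
    using comp_embed_in comp_norm_embed by metis
next
  fix A assume C: "\<forall>v\<in>V. norm (\<phi> (comp_embed V N v)) \<le> C * N v" and A: "A \<in> completion V N"
  obtain \<sigma> where \<sigma>: "\<sigma> \<in> cauchy_seqs V N" "A = cls \<sigma>" using completionE[OF A] .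
  show "norm (\<phi> A) \<le> C * comp_norm N A"
    unfolding \<sigma>(2)
    using tendsto_norm[OF comp_dual_cls[OF \<phi> \<sigma>(1)]] tendsto_mult_left[OF comp_norm_cls[OF \<sigma>(1)], of C]
    by (rule LIMSEQ_le) (use C cauchy_seqs_in[OF \<sigma>(1)] in blast)
qed

lemma comp_dual_bounded:
  assumes "\<phi> \<in> comp_dual s V N"
  obtains C where "0 \<le> C" "bounded_by (\<lambda>v. \<phi> (comp_embed V N v)) C"
proof -
  obtain C where "\<forall>A\<in>completion V N. norm (\<phi> A) \<le> C * comp_norm N A"
    using assms unfolding comp_dual_def by blast
  then have C: "bounded_by (\<lambda>v. \<phi> (comp_embed V N v)) C"
    by (simp add: comp_dual_bound_iff[OF assms])
  have "bounded_by (\<lambda>v. \<phi> (comp_embed V N v)) \<bar>C\<bar>"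
    unfolding bounded_by_def
  proof
    fix v assume v: "v \<in> V"
    have "C * N v \<le> \<bar>C\<bar> * N v" by (rule mult_right_mono) (auto simp: N_nonneg v)
    then show "norm (\<phi> (comp_embed V N v)) \<le> \<bar>C\<bar> * N v"
      using C v unfolding bounded_by_def by force
  qed
  then show thesis using that[of "\<bar>C\<bar>"] by simp
qed

lemma comp_dual_norm_eq:
  "\<phi> \<in> comp_dual s V N \<Longrightarrow>
    comp_dual_norm V N \<phi> = Inf {C. 0 \<le> C \<and> bounded_by (\<lambda>v. \<phi> (comp_embed V N v)) C}"
  unfolding comp_dual_norm_def by (simp add: comp_dual_bound_iff)

end

section \<open>The Lipschitz tensor product as a space of functionals\<close>

lemma Lip_le: "L-lipschitz_on UNIV f \<Longrightarrow> Lip f \<le> L"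
  unfolding Lip_def by (rule cInf_lower) (auto intro: bdd_belowI[of _ 0] lipschitz_on_nonneg)

lemma lipschitz_on_Lip:
  assumes "L-lipschitz_on UNIV f"
  shows "(Lip f)-lipschitz_on UNIV f"
proof (rule lipschitz_onI)
  have ne: "{L. L-lipschitz_on UNIV f} \<noteq> {}" using assms by blast
  show "0 \<le> Lip f"
    unfolding Lip_def using ne by (rule cInf_greatest) (auto intro: lipschitz_on_nonneg)
  fix x y
  show "dist (f x) (f y) \<le> Lip f * dist x y"
  proof (cases "x = y")
    case False
    have "dist (f x) (f y) / dist x y \<le> Lip f"
      unfolding Lip_def using ne
      by (rule cInf_greatest)
        (use False in \<open>auto simp: field_simps dest: lipschitz_onD[where x=x and y=y]\<close>)
    with False show ?thesis by (simp add: field_simps)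
  qed simp
qed

lemma sum_fun_apply: "(\<Sum>i\<in>A. h i) x = (\<Sum>i\<in>A. h i x)"
  by (induction A rule: infinite_finite_induct) auto

lemma scaleD_apply: "blinfun_apply (scaleD c \<phi>) e = c * blinfun_apply \<phi> e"
  by (simp add: scaleD_def)

lemma norm_scaleD_le: "norm (scaleD c \<phi>) \<le> norm c * norm \<phi>"
proof (rule norm_blinfun_bound)
  fix e
  have "norm c * norm (blinfun_apply \<phi> e) \<le> norm c * (norm \<phi> * norm e)"
    by (intro mult_left_mono norm_blinfun) simp
  then show "norm (blinfun_apply (scaleD c \<phi>) e) \<le> norm c * norm \<phi> * norm e"
    by (simp add: scaleD_apply norm_mult mult.assoc)
qed simp

interpretation tensor: vector_space scale_fun
  by (rule vector_space_scale_fun)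

locale lipschitz_tensor = scalar_banach sE
  for sE :: "'k::real_or_complex \<Rightarrow> 'e::banach \<Rightarrow> 'e" +
  fixes z :: "'x::metric_space"
begin

abbreviation "T \<equiv> lip_tensor sE z"
abbreviation "L0 \<equiv> Lip0 sE z"
abbreviation "el \<equiv> elt sE z"

lemma Lip0_base: "f \<in> L0 \<Longrightarrow> f z = 0"
  and Lip0_homogeneous: "f \<in> L0 \<Longrightarrow> blinfun_apply (f x) (sE c e) = c * blinfun_apply (f x) e"
  by (auto simp: Lip0_def dualE_def)

lemma Lip0_add:
  assumes "f \<in> L0" "g \<in> L0"
  shows "f + g \<in> L0"
proof -
  obtain L M where "L-lipschitz_on UNIV f" "M-lipschitz_on UNIV g"
    using assms by (auto simp: Lip0_def)
  then have "(L + M)-lipschitz_on UNIV (f + g)"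
    unfolding plus_fun_def by (rule lipschitz_on_add)
  then show ?thesis
    using assms by (auto simp: Lip0_def dualE_def blinfun.add_left distrib_left image_subset_iff)
qed

lemma lipschitz_on_rank_one:
  assumes "L-lipschitz_on UNIV g"
  shows "(L * norm \<phi>)-lipschitz_on UNIV (\<lambda>x. scaleD (g x) \<phi>)"
proof (rule lipschitz_onI)
  fix x y
  have "scaleD (g x) \<phi> - scaleD (g y) \<phi> = scaleD (g x - g y) \<phi>"
    by (rule blinfun_eqI) (simp add: scaleD_apply blinfun.diff_left left_diff_distrib)
  then have "dist (scaleD (g x) \<phi>) (scaleD (g y) \<phi>) \<le> dist (g x) (g y) * norm \<phi>"
    using norm_scaleD_le[of "g x - g y" \<phi>] by (simp add: dist_norm)
  also have "\<dots> \<le> L * dist x y * norm \<phi>"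
    using lipschitz_onD[OF assms] by (intro mult_right_mono) auto
  finally show "dist (scaleD (g x) \<phi>) (scaleD (g y) \<phi>) \<le> L * norm \<phi> * dist x y"
    by (simp add: algebra_simps)
qed (simp add: lipschitz_on_nonneg[OF assms])

lemma Lip0_scale:
  assumes "f \<in> L0"
  shows "scale_op c f \<in> L0"
proof -
  obtain L where L: "L-lipschitz_on UNIV f"
    using assms by (auto simp: Lip0_def)
  have "(norm c * L)-lipschitz_on UNIV (scale_op c f)"
  proof (rule lipschitz_onI)
    fix x y
    have "scale_op c f x - scale_op c f y = scaleD c (f x - f y)"
      by (rule blinfun_eqI) (simp add: scale_op_def scaleD_apply blinfun.diff_left right_diff_distrib)
    then have "dist (scale_op c f x) (scale_op c f y) \<le> norm c * dist (f x) (f y)"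
      using norm_scaleD_le[of c "f x - f y"] by (simp add: dist_norm)
    also have "\<dots> \<le> norm c * (L * dist x y)"
      using lipschitz_onD[OF L] by (intro mult_left_mono) auto
    finally show "dist (scale_op c f x) (scale_op c f y) \<le> norm c * L * dist x y"
      by (simp add: algebra_simps)
  qed (simp add: lipschitz_on_nonneg[OF L])
  moreover have "scale_op c f z = 0"
    by (rule blinfun_eqI) (simp add: scale_op_def scaleD_apply Lip0_base[OF assms])
  ultimately show ?thesis
    using Lip0_homogeneous[OF assms]
    by (auto simp: Lip0_def dualE_def scale_op_def scaleD_apply mult.left_commute)
qed

lemma elt_apply: "f \<in> L0 \<Longrightarrow> el x y e f = blinfun_apply (f x) e - blinfun_apply (f y) e"
  by (simp add: elt_def blinfun.diff_left)

lemma elt_base_apply: "f \<in> L0 \<Longrightarrow> el x z e f = blinfun_apply (f x) e"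
  by (simp add: elt_apply Lip0_base)

lemma elt_add: "el x y (e + e') = el x y e + el x y e'"
  by (auto simp: elt_def blinfun.add_right)

lemma elt_scale: "el x y (sE c e) = scale_fun c (el x y e)"
  by (rule ext) (simp add: elt_def scale_fun_def blinfun.diff_left Lip0_homogeneous right_diff_distrib)

lemma elt_via_base: "el x y e = el x z e - el y z e"
  by (auto simp: elt_def blinfun.diff_left)

lemma elt_zero: "el x y 0 = 0"
  by (auto simp: elt_def)

lemma elt_in: "el x y e \<in> T"
  unfolding lip_tensor_def by (rule tensor.span_base) blast

lemma subspace_T: "tensor.subspace T"
  unfolding lip_tensor_def by (rule tensor.subspace_span)

lemma T_zero: "0 \<in> T"
  and T_add: "u \<in> T \<Longrightarrow> v \<in> T \<Longrightarrow> u + v \<in> T"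
  and T_scale: "u \<in> T \<Longrightarrow> scale_fun c u \<in> T"
  and T_sum: "(\<And>i. i \<in> A \<Longrightarrow> h i \<in> T) \<Longrightarrow> sum h A \<in> T"
  using subspace_T by (simp_all add: tensor.subspace_0 tensor.subspace_add tensor.subspace_scale tensor.subspace_sum)

text \<open>
  The scalar is moved into the vector of \<open>E\<close>, where the operators are homogeneous.
\<close>

lemma tensor_induct [consumes 1, case_names zero step]:
  assumes "u \<in> T" "P 0"
    and "\<And>c x y e u. u \<in> T \<Longrightarrow> P u \<Longrightarrow> P (el x y (sE c e) + u)"
  shows "P u"
proof -
  have "u \<in> T \<and> P u"
    using assms(1) unfolding lip_tensor_def
  proof (induction rule: tensor.span_induct_alt)
    case base
    then show ?case using assms(2) T_zero by (simp add: lip_tensor_def zero_fun_def)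
  next
    case (step c v u)
    then obtain x y e where "v = el x y e" by blast
    then have v: "scale_fun c v = el x y (sE c e)" by (simp add: elt_scale)
    show ?case
      using step assms(3)[of u x y c e] T_add[OF elt_in, of u x y "sE c e"]
      unfolding v lip_tensor_def by blast
  qed
  then show ?thesis ..
qed

lemma tensor_linear:
  assumes "u \<in> T" "f \<in> L0" "g \<in> L0"
  shows "u (f + g) = u f + u g" "u (scale_op c f) = c * u f"
proof -
  define h where "h = f + g"
  have h: "el x y w h = el x y w f + el x y w g" for x y w
    unfolding h_def elt_apply[OF Lip0_add[OF assms(2,3)]] elt_apply[OF assms(2)] elt_apply[OF assms(3)]
    by (simp add: blinfun.add_left)
  have scale: "el x y w (scale_op c f) = c * el x y w f" for x y w
    unfolding elt_apply[OF Lip0_scale[OF assms(2)]] elt_apply[OF assms(2)]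
    by (simp add: scale_op_def scaleD_apply right_diff_distrib)
  have "u h = u f + u g \<and> u (scale_op c f) = c * u f"
    using assms(1)
  proof (induction rule: tensor_induct)
    case zero
    then show ?case by simp
  next
    case (step c x y e u)
    then show ?case by (simp add: h scale distrib_left add_ac)
  qed
  then show "u (f + g) = u f + u g" "u (scale_op c f) = c * u f" by (auto simp: h_def)
qed

lemma Lip0_eqI:
  assumes "f \<in> L0" "g \<in> L0" "\<And>u. u \<in> T \<Longrightarrow> u f = u g"
  shows "f = g"
proof (rule ext, rule blinfun_eqI)
  fix x e
  show "blinfun_apply (f x) e = blinfun_apply (g x) e"
    using assms(3)[OF elt_in[of x z e]] by (simp add: elt_base_apply assms(1,2))
qed

text \<open>
  Referring every pair of points to the base point and collecting the terms at each point gives a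
  representation indexed by distinct points. This normal form is what makes it possible to isolate
  a single coefficient in \<open>rank_one_separates\<close>.
\<close>

lemma tensor_representation:
  assumes "u \<in> T"
  obtains S e where "finite S" "u = (\<Sum>s\<in>S. el s z (e s))"
proof -
  define R where "R u \<longleftrightarrow> (\<exists>S e. finite S \<and> u = (\<Sum>s\<in>S. el s z (e s)))" for u
  have single: "R (el a z w + u)" if u: "R u" for a w u
  proof -
    obtain S e where S: "finite S" "u = (\<Sum>s\<in>S. el s z (e s))" using u unfolding R_def by blast
    define e' where "e' = e(a := (if a \<in> S then e a else 0) + w)"
    have "(\<Sum>s\<in>insert a S. el s z (e' s)) = el a z (e' a) + (\<Sum>s\<in>S - {a}. el s z (e' s))"
      using S(1) by (simp add: sum.insert_remove)
    also have "(\<Sum>s\<in>S - {a}. el s z (e' s)) = (\<Sum>s\<in>S - {a}. el s z (e s))"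
      by (intro sum.cong) (auto simp: e'_def)
    also have "el a z (e' a) + \<dots> = el a z w + u"
      by (cases "a \<in> S") (auto simp: S e'_def elt_add sum.remove algebra_simps)
    finally show ?thesis using S(1) unfolding R_def by (metis finite_insert)
  qed
  have "R u"
    using assms
  proof (induction rule: tensor_induct)
    case zero
    then show ?case unfolding R_def by (intro exI[of _ "{}"]) simp
  next
    case (step c x y e u)
    have "el x y (sE c e) = el x z (sE c e) + el y z (sE (- 1) (sE c e))"
      by (subst elt_via_base, subst elt_scale[of y z "- 1"]) (auto simp: scale_fun_def)
    then show ?case
      using single[OF single[OF step(2), of y "sE (- 1) (sE c e)"], of x "sE c e"]
      by (simp add: add.assoc plus_fun_def)
  qed
  then show thesis using that unfolding R_def by blast
qed

lemma tensor_representation_nat: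
  assumes "u \<in> T"
  obtains n :: nat and x y e where "u = (\<Sum>i<n. el (x i) (y i) (e i))"
proof -
  obtain S e where S: "finite S" "u = (\<Sum>s\<in>S. el s z (e s))"
    using tensor_representation[OF assms] .
  obtain x where "bij_betw x {..<card S} S"
    using ex_bij_betw_nat_finite[OF S(1)] by (auto simp: atLeast0LessThan)
  then have "u = (\<Sum>i<card S. el (x i) z (e (x i)))"
    unfolding S(2) by (rule sum.reindex_bij_betw[symmetric])
  then show thesis by (rule that)
qed

lemma sum_elt_apply:
  "f \<in> L0 \<Longrightarrow> (\<Sum>i\<in>A. el (x i) (y i) (e i)) f = (\<Sum>i\<in>A. blinfun_apply (f (x i) - f (y i)) (e i))"
  by (simp add: sum_fun_apply elt_apply blinfun.diff_left)

lemma all_tensor_iff: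
  "(\<forall>u\<in>T. P u) \<longleftrightarrow> (\<forall>(n::nat) x y e. P (\<Sum>i<n. el (x i) (y i) (e i)))"
proof (intro iffI ballI)
  fix u assume "\<forall>(n::nat) x y e. P (\<Sum>i<n. el (x i) (y i) (e i))" "u \<in> T"
  then show "P u" by (metis tensor_representation_nat)
qed (simp add: T_sum elt_in)

text \<open>
  The operator is forced: its value at \<open>x\<close> must be \<open>\<lambda>e. \<psi> (el x z e)\<close>. The bound on elementary
  tensors is both the continuity of this functional in \<open>e\<close> and the Lipschitz condition in \<open>x\<close>.
\<close>

lemma functional_is_evaluation:
  assumes add: "\<And>u v. u \<in> T \<Longrightarrow> v \<in> T \<Longrightarrow> \<psi> (u + v) = \<psi> u + \<psi> v"
    and scale: "\<And>c u. u \<in> T \<Longrightarrow> \<psi> (scale_fun c u) = c * \<psi> u"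
    and "0 \<le> C" and bound: "\<And>x y e. norm (\<psi> (el x y e)) \<le> C * dist x y * norm e"
  obtains f where "f \<in> L0" "\<And>u. u \<in> T \<Longrightarrow> u f = \<psi> u"
proof -
  have diff: "\<psi> (el x y e) = \<psi> (el x z e) - \<psi> (el y z e)" for x y e
  proof -
    have "el x y e + el y z e = el x z e" by (subst (1) elt_via_base) simp
    then show ?thesis using add[OF elt_in elt_in, of x y e y z e] by simp
  qed
  have homogeneous: "\<psi> (el x z (sE c e)) = c * \<psi> (el x z e)" for x c e
    by (simp add: elt_scale scale elt_in)
  have bl: "bounded_linear (\<lambda>e. \<psi> (el x z e))" for x
  proof (rule bounded_linear_intro[of _ "C * dist x z"])
    show "\<psi> (el x z (e + e')) = \<psi> (el x z e) + \<psi> (el x z e')" for e e'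
      by (simp add: elt_add add elt_in)
    show "\<psi> (el x z (r *\<^sub>R e)) = r *\<^sub>R \<psi> (el x z e)" for r e
      using homogeneous[of x "of_real r" e] by (simp add: scale_of_real scaleR_conv_of_real)
    show "norm (\<psi> (el x z e)) \<le> norm e * (C * dist x z)" for e
      using bound[of x z e] by (simp add: algebra_simps)
  qed
  define f where "f x = Blinfun (\<lambda>e. \<psi> (el x z e))" for x
  have f: "blinfun_apply (f x) e = \<psi> (el x z e)" for x e
    by (simp add: f_def bounded_linear_Blinfun_apply[OF bl])
  have "C-lipschitz_on UNIV f"
  proof (rule lipschitz_onI)
    show "dist (f x) (f y) \<le> C * dist x y" for x y
      unfolding dist_norm
      by (rule norm_blinfun_bound)
        (use bound[of x y] \<open>0 \<le> C\<close> in \<open>auto simp: blinfun.diff_left f dist_norm simp flip: diff\<close>)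
  qed fact
  moreover have "f z = 0"
    by (rule blinfun_eqI) (use bound[of z z] in \<open>simp add: f\<close>)
  ultimately have "f \<in> L0"
    by (auto simp: Lip0_def dualE_def f homogeneous)
  moreover have "u f = \<psi> u" if "u \<in> T" for u
    using that
  proof (induction rule: tensor_induct)
    case zero
    then show ?case using scale[OF T_zero, of 0] by (simp add: scale_fun_def zero_fun_def)
  next
    case (step c x y e u)
    then show ?case
      using \<open>f \<in> L0\<close> diff[of x y "sE c e"] add[OF elt_in step(1), of x y "sE c e"]
      by (simp add: elt_apply f plus_fun_def)
  qed
  ultimately show thesis using that by blast
qed

section \<open>Rank-one operators separate the tensor product\<close>

lemma lip_dualI: "g z = 0 \<Longrightarrow> L-lipschitz_on UNIV g \<Longrightarrow> g \<in> lip_dual z"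
  by (auto simp: lip_dual_def)

lemma rank_one_Lip0:
  assumes "g \<in> lip_dual z" "\<phi> \<in> dualE sE"
  shows "(\<lambda>x. scaleD (g x) \<phi>) \<in> L0"
proof -
  have "g z = 0" and "\<exists>L. L-lipschitz_on UNIV g"
    using assms(1) by (auto simp: lip_dual_def)
  moreover have "scaleD 0 \<phi> = 0"
    by (rule blinfun_eqI) (simp add: scaleD_apply)
  ultimately show ?thesis
    using assms(2) lipschitz_on_rank_one[of _ g \<phi>]
    by (auto simp: Lip0_def dualE_def scaleD_apply)
qed

lemma sum_elt_rank_one:
  assumes "g \<in> lip_dual z" "\<phi> \<in> dualE sE"
  shows "(\<Sum>i\<in>A. el (x i) (y i) (e i)) (\<lambda>x. scaleD (g x) \<phi>)
    = (\<Sum>i\<in>A. (g (x i) - g (y i)) * blinfun_apply \<phi> (e i))"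
  by (simp add: sum_elt_apply[OF rank_one_Lip0[OF assms]] blinfun.diff_left scaleD_apply
      left_diff_distrib)

text \<open>
  The distance to \<open>y\<close>, normalised at the base point, realises \<open>dist x y\<close>, and a norming functional
  realises \<open>norm e\<close>. This is the lower estimate in the cross-norm identity.
\<close>

lemma rank_one_norming:
  obtains g and \<phi> :: "'e \<Rightarrow>\<^sub>L 'k" where "g \<in> lip_dual z" "\<phi> \<in> dualE sE"
    "Lip g * norm \<phi> \<le> 1"
    "el x y e (\<lambda>w. scaleD (g w) \<phi>) = of_real (dist x y * norm e)"
proof -
  obtain \<phi> :: "'e \<Rightarrow>\<^sub>L 'k" where \<phi>: "\<phi> \<in> dualE sE" "norm \<phi> \<le> 1" "blinfun_apply \<phi> e = of_real (norm e)"
    using norming_functional[OF scalar_banach_axioms] .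
  define g :: "'x \<Rightarrow> 'k" where "g w = of_real (dist w y - dist z y)" for w
  have lip: "1-lipschitz_on UNIV g"
  proof (rule lipschitz_onI)
    fix v w
    have "dist (g v) (g w) = \<bar>dist v y - dist w y\<bar>"
      by (simp add: g_def dist_norm flip: of_real_diff)
    also have "\<dots> \<le> dist v w"
      using dist_triangle[of v y w] dist_triangle[of w y v] by (simp add: dist_commute abs_le_iff)
    finally show "dist (g v) (g w) \<le> 1 * dist v w" by simp
  qed simp
  then have g: "g \<in> lip_dual z"
    by (rule lip_dualI[rotated]) (simp add: g_def)
  have "Lip g * norm \<phi> \<le> 1 * 1"
    using Lip_le[OF lip] \<phi>(2) by (intro mult_mono) auto
  moreover have "el x y e (\<lambda>w. scaleD (g w) \<phi>) = of_real (dist x y * norm e)"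
    unfolding elt_apply[OF rank_one_Lip0[OF g \<phi>(1)]]
    by (simp add: scaleD_apply \<phi>(3) g_def left_diff_distrib)
  ultimately show thesis using that g \<phi>(1) by simp
qed

text \<open>
  A Lipschitz bump at one point \<open>s\<close> of the support kills all other terms of the representation, so
  that every functional on \<open>E\<close> vanishes at the coefficient of \<open>s\<close>; by the Hahn--Banach theorem the
  coefficient is zero.
\<close>

lemma rank_one_separates:
  assumes u: "u \<in> T"
    and zero: "\<And>g \<phi>. g \<in> lip_dual z \<Longrightarrow> \<phi> \<in> dualE sE \<Longrightarrow> u (\<lambda>x. scaleD (g x) \<phi>) = 0"
  shows "u = 0"
proof -
  obtain S e where S: "finite S" "u = (\<Sum>s\<in>S. el s z (e s))"
    using tensor_representation[OF u] .
  have e0: "e s = 0" if s: "s \<in> S" "s \<noteq> z" for s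
  proof -
    have "finite (insert z S)" using S(1) by simp
    then obtain r where r: "0 < r" "\<And>t. t \<in> insert z S \<Longrightarrow> t \<noteq> s \<Longrightarrow> r \<le> dist s t"
      using finite_set_avoid[of "insert z S" s] by blast
    obtain \<phi> :: "'e \<Rightarrow>\<^sub>L 'k" where \<phi>: "\<phi> \<in> dualE sE" "blinfun_apply \<phi> (e s) = of_real (norm (e s))"
      using norming_functional[OF scalar_banach_axioms, of "e s"] by blast
    define g :: "'x \<Rightarrow> 'k" where "g w = of_real (max 0 (r - dist s w))" for w
    have "1-lipschitz_on UNIV g"
    proof (rule lipschitz_onI)
      fix v w
      have "dist (g v) (g w) = \<bar>max 0 (r - dist s v) - max 0 (r - dist s w)\<bar>"
        by (simp add: g_def dist_norm flip: of_real_diff)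
      also have "\<dots> \<le> dist v w"
        using dist_triangle[of s v w] dist_triangle[of s w v] by (auto simp: dist_commute)
      finally show "dist (g v) (g w) \<le> 1 * dist v w" by simp
    qed simp
    moreover have off: "g t = 0" if "t \<in> insert z S" "t \<noteq> s" for t
      using r(2)[OF that] by (simp add: g_def)
    ultimately have g: "g \<in> lip_dual z" using s(2) by (intro lip_dualI) auto
    have "0 = (\<Sum>t\<in>S. (g t - g z) * blinfun_apply \<phi> (e t))"
      using zero[OF g \<phi>(1)] unfolding S(2) by (simp add: sum_elt_rank_one[OF g \<phi>(1)])
    also have "\<dots> = g s * blinfun_apply \<phi> (e s)"
      using off s by (subst sum.remove[OF S(1) s(1)]) (simp add: sum.neutral)
    finally show ?thesis
      using r(1) by (simp add: g_def \<phi>(2))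
  qed
  have "el s z (e s) = 0" if "s \<in> S" for s
    using e0[OF that] by (cases "s = z") (auto simp: elt_zero elt_def)
  then show ?thesis unfolding S(2) by (simp add: sum.neutral)
qed

end

context lipschitz_tensor
begin

section \<open>Lipschitz operators of a cross-norm\<close>

lemma alpha_bound_iff:
  assumes "f \<in> L0"
  shows "alpha_bound sE z \<alpha> f C \<longleftrightarrow> 0 \<le> C \<and> (\<forall>u\<in>T. norm (u f) \<le> C * \<alpha> u)"
  unfolding alpha_bound_def all_tensor_iff[of "\<lambda>u. norm (u f) \<le> C * \<alpha> u"]
  by (simp add: sum_elt_apply[OF assms])

text \<open>
  The inequality for a single elementary tensor is the Lipschitz condition, by the cross-norm
  identity.
\<close>

lemma Lip_alpha_space_subset_Lip0:
  assumes \<alpha>: "lip_cross_norm sE z \<alpha>" and f: "f \<in> Lip_alpha_space sE z \<alpha>"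
  shows "f \<in> L0"
proof -
  have f0: "f z = 0" "range f \<subseteq> dualE sE"
    using f by (auto simp: Lip_alpha_space_def)
  obtain C where C: "0 \<le> C" and bound: "\<And>(n::nat) x y e.
      norm (\<Sum>i<n. blinfun_apply (f (x i) - f (y i)) (e i)) \<le> C * \<alpha> (\<Sum>i<n. el (x i) (y i) (e i))"
    using f by (auto simp: Lip_alpha_space_def alpha_bound_def)
  have "C-lipschitz_on UNIV f"
  proof (rule lipschitz_onI)
    fix x y
    have "norm (blinfun_apply (f x - f y) e) \<le> C * dist x y * norm e" for e
    proof -
      have "norm (blinfun_apply (f x - f y) e) \<le> C * \<alpha> (el x y e)"
        using bound[where n = 1 and x = "\<lambda>_. x" and y = "\<lambda>_. y" and e = "\<lambda>_. e"] by simp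
      then show ?thesis
        using \<alpha> by (simp add: lip_cross_norm_def)
    qed
    then show "dist (f x) (f y) \<le> C * dist x y"
      unfolding dist_norm using C by (intro norm_blinfun_bound) auto
  qed (rule C)
  then show ?thesis using f0 by (auto simp: Lip0_def)
qed

lemma Lip_alpha_space_iff:
  assumes "lip_cross_norm sE z \<alpha>"
  shows "f \<in> Lip_alpha_space sE z \<alpha> \<longleftrightarrow> f \<in> L0 \<and> (\<exists>C. alpha_bound sE z \<alpha> f C)"
  using Lip_alpha_space_subset_Lip0[OF assms]
  by (auto simp: Lip_alpha_space_def Lip0_def)

lemma normed_subspace_tensor:
  "lip_cross_norm sE z \<alpha> \<Longrightarrow> normed_subspace scale_fun T \<alpha>"
  by unfold_locales (simp add: lip_cross_norm_def)

lemma linear_functional_evaluation: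
  assumes "lip_cross_norm sE z \<alpha>"
  shows "normed_subspace.linear_functional scale_fun T (\<lambda>u. u f)"
  unfolding normed_subspace.linear_functional_def[OF normed_subspace_tensor[OF assms]]
  by (simp add: scale_fun_def)

lemma bounded_by_evaluation_iff:
  assumes \<alpha>: "lip_cross_norm sE z \<alpha>" and f: "f \<in> L0"
  shows "alpha_bound sE z \<alpha> f C
    \<longleftrightarrow> 0 \<le> C \<and> normed_subspace.bounded_by T \<alpha> (\<lambda>u. u f) C"
  unfolding alpha_bound_iff[OF f] normed_subspace.bounded_by_def[OF normed_subspace_tensor[OF \<alpha>]]
  by (rule refl)

text \<open>
  The isometry extends the evaluation functional at \<open>f\<close> to the completion. Surjectivity is
  \<open>functional_is_evaluation\<close> applied to the restriction of a given functional to the tensor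
  product.
\<close>

lemma canonical_iso_Lip_alpha:
  assumes \<alpha>: "lip_cross_norm sE z \<alpha>"
  shows "\<exists>J. canonical_iso sE z \<alpha> (Lip_alpha_space sE z \<alpha>) (Lip_alpha sE z \<alpha>) J"
proof -
  interpret N: normed_subspace scale_fun T \<alpha> by (rule normed_subspace_tensor[OF \<alpha>])
  let ?L = "Lip_alpha_space sE z \<alpha>"
  define J where "J f = N.extension (\<lambda>u. u f)" for f
  note L0 = Lip_alpha_space_subset_Lip0[OF \<alpha>]
  note lin = linear_functional_evaluation[OF \<alpha>]
  have bounded: "\<exists>C\<ge>0. N.bounded_by (\<lambda>u. u f) C" if "f \<in> ?L" for f
    using that bounded_by_evaluation_iff[OF \<alpha>] by (auto simp: Lip_alpha_space_iff[OF \<alpha>])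
  have dual: "J f \<in> comp_dual scale_fun T \<alpha>" if "f \<in> ?L" for f
    using bounded[OF that] N.extension_in_comp_dual[OF lin] unfolding J_def by blast
  have embed: "J f (comp_embed T \<alpha> u) = u f" if "f \<in> ?L" "u \<in> T" for f u
    using bounded[OF that(1)] N.extension_embed[OF lin _ that(2)] unfolding J_def by blast
  have bound_add: "f + g \<in> ?L" if f: "f \<in> ?L" and g: "g \<in> ?L" for f g
  proof -
    obtain C D where CD: "N.bounded_by (\<lambda>u. u f) C" "N.bounded_by (\<lambda>u. u g) D" "0 \<le> C" "0 \<le> D"
      using bounded[OF f] bounded[OF g] by blast
    have "norm (u (f + g)) \<le> (C + D) * \<alpha> u" if u: "u \<in> T" for u
    proof -
      have "norm (u f + u g) \<le> C * \<alpha> u + D * \<alpha> u"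
        using CD(1,2) u by (intro norm_triangle_mono) (auto simp: N.bounded_by_def)
      then show ?thesis
        unfolding tensor_linear(1)[OF u L0[OF f] L0[OF g]]
        by (simp add: algebra_simps)
    qed
    then show ?thesis
      using Lip0_add[OF L0[OF f] L0[OF g]] CD(3,4)
      unfolding Lip_alpha_space_iff[OF \<alpha>]
      by (intro conjI exI[of _ "C + D"]) (simp_all only: alpha_bound_iff, simp)
  qed
  have bound_scale: "scale_op c f \<in> ?L" if f: "f \<in> ?L" for c f
  proof -
    obtain C where C: "N.bounded_by (\<lambda>u. u f) C" "0 \<le> C"
      using bounded[OF f] by blast
    have "norm (u (scale_op c f)) \<le> (norm c * C) * \<alpha> u" if u: "u \<in> T" for u
      using C u mult_left_mono[of "norm (u f)" "C * \<alpha> u" "norm c"]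
      by (simp add: tensor_linear(2)[OF u L0[OF f] L0[OF f]]
          norm_mult N.bounded_by_def mult.assoc)
    then show ?thesis
      using Lip0_scale[OF L0[OF f]] C(2)
      by (auto simp: Lip_alpha_space_iff[OF \<alpha>] alpha_bound_iff intro!: exI[of _ "norm c * C"])
  qed
  have inj: "inj_on J ?L"
  proof (rule inj_onI)
    fix f g assume fg: "f \<in> ?L" "g \<in> ?L" "J f = J g"
    then have "u f = u g" if "u \<in> T" for u
      using embed[OF fg(1) that] embed[OF fg(2) that] by simp
    then show "f = g" by (rule Lip0_eqI[OF L0[OF fg(1)] L0[OF fg(2)]])
  qed
  have surj: "\<exists>f\<in>?L. J f = \<phi>" if \<phi>: "\<phi> \<in> comp_dual scale_fun T \<alpha>" for \<phi>
  proof -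
    obtain C where C: "0 \<le> C" "N.bounded_by (\<lambda>u. \<phi> (comp_embed T \<alpha> u)) C"
      using N.comp_dual_bounded[OF \<phi>] .
    have "norm (\<phi> (comp_embed T \<alpha> (el x y e))) \<le> C * dist x y * norm e" for x y e
    proof -
      have "\<alpha> (el x y e) = dist x y * norm e" using \<alpha> by (simp add: lip_cross_norm_def)
      then show ?thesis using C(2) elt_in[of x y e] by (auto simp: N.bounded_by_def mult.assoc)
    qed
    then obtain f where f: "f \<in> L0" "\<And>u. u \<in> T \<Longrightarrow> u f = \<phi> (comp_embed T \<alpha> u)"
      using functional_is_evaluation[of "\<lambda>u. \<phi> (comp_embed T \<alpha> u)" C]
        N.comp_dual_restrict[OF \<phi>] C(1) unfolding N.linear_functional_def by blast
    have "alpha_bound sE z \<alpha> f C"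
      using C f(2) by (simp add: bounded_by_evaluation_iff[OF \<alpha> f(1)] N.bounded_by_def)
    then have "f \<in> ?L" using f(1) Lip_alpha_space_iff[OF \<alpha>] by blast
    moreover have "J f = \<phi>"
      using embed[OF \<open>f \<in> ?L\<close>] f(2) by (intro N.comp_dual_eqI[OF dual[OF \<open>f \<in> ?L\<close>] \<phi>]) simp
    ultimately show ?thesis by blast
  qed
  have "canonical_iso sE z \<alpha> ?L (Lip_alpha sE z \<alpha>) J"
    unfolding canonical_iso_def
  proof (intro conjI ballI allI)
    show "bij_betw J ?L (comp_dual scale_fun T \<alpha>)"
      unfolding bij_betw_def using inj dual surj by blast
  next
    fix f g assume f: "f \<in> ?L" and g: "g \<in> ?L"
    have "J f + J g \<in> comp_dual scale_fun T \<alpha>"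
    proof -
      obtain C D where "\<forall>A\<in>completion T \<alpha>. norm (J f A) \<le> C * comp_norm \<alpha> A"
        "\<forall>A\<in>completion T \<alpha>. norm (J g A) \<le> D * comp_norm \<alpha> A"
        using dual[OF f] dual[OF g] unfolding comp_dual_def by blast
      then have "\<forall>A\<in>completion T \<alpha>. norm (J f A + J g A) \<le> (C + D) * comp_norm \<alpha> A"
        by (auto simp: distrib_right intro!: norm_triangle_mono)
      then show ?thesis
        using dual[OF f] dual[OF g] unfolding comp_dual_def
        by (auto simp: distrib_left)
    qed
    then show "J (f + g) = J f + J g"
      by (rule N.comp_dual_eqI[OF dual[OF bound_add[OF f g]]])
        (simp only: plus_fun_apply embed bound_add f g tensor_linear(1)[OF _ L0[OF f] L0[OF g]])
  next
    fix c f assume f: "f \<in> ?L"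
    have "scale_fun c (J f) \<in> comp_dual scale_fun T \<alpha>"
    proof -
      obtain C where C: "\<forall>A\<in>completion T \<alpha>. norm (J f A) \<le> C * comp_norm \<alpha> A"
        using dual[OF f] unfolding comp_dual_def by blast
      have "norm (c * J f A) \<le> (norm c * C) * comp_norm \<alpha> A" if "A \<in> completion T \<alpha>" for A
        using C that mult_left_mono[of "norm (J f A)" "C * comp_norm \<alpha> A" "norm c"]
        by (simp add: norm_mult mult.assoc)
      then show ?thesis
        using dual[OF f] unfolding comp_dual_def scale_fun_def
        by (auto simp: distrib_left mult.left_commute)
    qed
    then show "J (scale_op c f) = scale_fun c (J f)"
      by (rule N.comp_dual_eqI[OF dual[OF bound_scale[OF f]]])
        (simp add: scale_fun_def embed bound_scale f tensor_linear(2)[OF _ L0[OF f] L0[OF f]])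
  next
    fix f assume f: "f \<in> ?L"
    have "N.bounded_by (\<lambda>v. J f (comp_embed T \<alpha> v)) C \<longleftrightarrow> N.bounded_by (\<lambda>u. u f) C" for C
      by (simp add: N.bounded_by_def embed[OF f])
    then show "comp_dual_norm T \<alpha> (J f) = Lip_alpha sE z \<alpha> f"
      by (simp add: N.comp_dual_norm_eq[OF dual[OF f]] Lip_alpha_def
          bounded_by_evaluation_iff[OF \<alpha> L0[OF f]])
  next
    fix f and n :: nat and x y e assume f: "f \<in> ?L"
    show "J f (comp_embed T \<alpha> (\<Sum>i<n. el (x i) (y i) (e i)))
        = (\<Sum>i<n. blinfun_apply (f (x i) - f (y i)) (e i))"
      by (subst embed[OF f]) (auto intro!: T_sum elt_in simp: sum_elt_apply[OF L0[OF f]])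
  qed
  then show ?thesis by blast
qed

text \<open>
  An arbitrary canonical isometry restricts to evaluation on the tensor product, so membership in
  \<open>B\<close> and the norm of \<open>B\<close> can be read off from the dual of the completion.
\<close>

lemma canonical_iso_determines:
  assumes \<alpha>: "lip_cross_norm sE z \<alpha>" and "B \<subseteq> L0" and J: "canonical_iso sE z \<alpha> B NB J"
  shows "B = Lip_alpha_space sE z \<alpha> \<and> (\<forall>f\<in>B. NB f = Lip_alpha sE z \<alpha> f)"
proof -
  interpret N: normed_subspace scale_fun T \<alpha> by (rule normed_subspace_tensor[OF \<alpha>])
  have bij: "bij_betw J B (comp_dual scale_fun T \<alpha>)"
    and iso: "\<And>f. f \<in> B \<Longrightarrow> comp_dual_norm T \<alpha> (J f) = NB f"
    and J_sum: "\<And>f (n::nat) x y e. f \<in> B \<Longrightarrow>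
      J f (comp_embed T \<alpha> (\<Sum>i<n. el (x i) (y i) (e i))) =
        (\<Sum>i<n. blinfun_apply (f (x i) - f (y i)) (e i))"
    using J unfolding canonical_iso_def by blast+
  have dual: "J f \<in> comp_dual scale_fun T \<alpha>" if "f \<in> B" for f
    using bij that by (rule bij_betwE[THEN bspec])
  have embed: "J f (comp_embed T \<alpha> u) = u f" if "f \<in> B" "u \<in> T" for f u
  proof -
    have "\<forall>u\<in>T. J f (comp_embed T \<alpha> u) = u f"
      unfolding all_tensor_iff[of "\<lambda>u. J f (comp_embed T \<alpha> u) = u f"]
      using J_sum[OF that(1)] \<open>B \<subseteq> L0\<close> that(1) by (simp add: sum_elt_apply subset_iff)
    then show ?thesis using that(2) by blast
  qed
  have bounded: "N.bounded_by (\<lambda>v. J f (comp_embed T \<alpha> v)) C \<longleftrightarrow> N.bounded_by (\<lambda>u. u f) C"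
    if "f \<in> B" for f C
    by (simp add: N.bounded_by_def embed[OF that])
  have "f \<in> Lip_alpha_space sE z \<alpha>" if fB: "f \<in> B" for f
  proof -
    have f: "f \<in> L0" using fB \<open>B \<subseteq> L0\<close> by blast
    obtain C where "0 \<le> C" "N.bounded_by (\<lambda>v. J f (comp_embed T \<alpha> v)) C"
      using N.comp_dual_bounded[OF dual[OF fB]] .
    then show ?thesis
      using f by (auto simp: Lip_alpha_space_iff[OF \<alpha>] bounded_by_evaluation_iff[OF \<alpha> f] bounded[OF fB])
  qed
  moreover have "f \<in> B" if f: "f \<in> Lip_alpha_space sE z \<alpha>" for f
  proof -
    have f0: "f \<in> L0" by (rule Lip_alpha_space_subset_Lip0[OF \<alpha> f])
    obtain C where C: "N.bounded_by (\<lambda>u. u f) C"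
      using f by (auto simp: Lip_alpha_space_iff[OF \<alpha>] bounded_by_evaluation_iff[OF \<alpha>])
    note lin = linear_functional_evaluation[OF \<alpha>, of f]
    obtain g where g: "g \<in> B" "J g = N.extension (\<lambda>u. u f)"
      using N.extension_in_comp_dual[OF lin C] bij unfolding bij_betw_def by (metis imageE)
    have "f = g"
    proof (rule Lip0_eqI[OF f0])
      show "g \<in> L0" using g(1) \<open>B \<subseteq> L0\<close> by blast
      show "u f = u g" if "u \<in> T" for u
        using embed[OF g(1) that] N.extension_embed[OF lin C that] g(2) by simp
    qed
    then show ?thesis using g(1) by simp
  qed
  moreover have "NB f = Lip_alpha sE z \<alpha> f" if "f \<in> B" for f
  proof -
    have f: "f \<in> L0" using that \<open>B \<subseteq> L0\<close> by blast
    show ?thesis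
      by (simp add: iso[OF that, symmetric] N.comp_dual_norm_eq[OF dual[OF that]] bounded[OF that]
          Lip_alpha_def bounded_by_evaluation_iff[OF \<alpha> f])
  qed
  ultimately show ?thesis by blast
qed

text \<open>
  The infimum defining \<open>Lip_alpha\<close> is attained, so the unit ball is a polar.
\<close>

lemma Lip_alpha_le_one_iff:
  assumes \<alpha>: "lip_cross_norm sE z \<alpha>"
  shows "f \<in> Lip_alpha_space sE z \<alpha> \<and> Lip_alpha sE z \<alpha> f \<le> 1
    \<longleftrightarrow> f \<in> L0 \<and> (\<forall>u\<in>T. norm (u f) \<le> \<alpha> u)"
proof
  have \<alpha>_nonneg: "0 \<le> \<alpha> u" if "u \<in> T" for u
    using \<alpha> that by (simp add: lip_cross_norm_def norm_on_def)
  assume f: "f \<in> Lip_alpha_space sE z \<alpha> \<and> Lip_alpha sE z \<alpha> f \<le> 1"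
  then have f0: "f \<in> L0" and ne: "{C. alpha_bound sE z \<alpha> f C} \<noteq> {}"
    by (auto simp: Lip_alpha_space_iff[OF \<alpha>])
  have "norm (u f) \<le> \<alpha> u" if u: "u \<in> T" for u
  proof (cases "\<alpha> u = 0")
    case True
    then show ?thesis using ne u by (auto simp: alpha_bound_iff[OF f0])
  next
    case False
    then have pos: "0 < \<alpha> u" using \<alpha>_nonneg[OF u] by simp
    have "norm (u f) / \<alpha> u \<le> Lip_alpha sE z \<alpha> f"
      unfolding Lip_alpha_def using ne
      by (rule cInf_greatest) (use u pos in \<open>auto simp: alpha_bound_iff[OF f0] pos_divide_le_eq\<close>)
    then have "norm (u f) / \<alpha> u \<le> 1" using f by linarith
    then show ?thesis using pos by simp
  qed
  then show "f \<in> L0 \<and> (\<forall>u\<in>T. norm (u f) \<le> \<alpha> u)" using f0 by blast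
next
  assume f: "f \<in> L0 \<and> (\<forall>u\<in>T. norm (u f) \<le> \<alpha> u)"
  then have one: "alpha_bound sE z \<alpha> f 1" by (simp add: alpha_bound_iff)
  moreover have "bdd_below {C. alpha_bound sE z \<alpha> f C}"
    by (rule bdd_belowI[of _ 0]) (simp add: alpha_bound_def)
  ultimately have "Lip_alpha sE z \<alpha> f \<le> 1"
    unfolding Lip_alpha_def by (intro cInf_lower) auto
  then show "f \<in> Lip_alpha_space sE z \<alpha> \<and> Lip_alpha sE z \<alpha> f \<le> 1"
    using f one Lip_alpha_space_iff[OF \<alpha>] by blast
qed

section \<open>The weak* Lipschitz operator topology\<close>

abbreviation "W \<equiv> weak_star_lip_topology sE z"

lemma topspace_weak_star: "topspace W = L0"
proof -
  have "{f \<in> L0. (0 :: ('x \<Rightarrow> 'e \<Rightarrow>\<^sub>L 'k) \<Rightarrow> 'k) f \<in> UNIV} = L0" by simp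
  then show ?thesis
    unfolding weak_star_lip_topology_def topology_generated_by_topspace
    using T_zero open_UNIV by blast
qed

lemma openin_weak_star: "u \<in> T \<Longrightarrow> open U \<Longrightarrow> openin W {f \<in> L0. u f \<in> U}"
  unfolding weak_star_lip_topology_def by (rule topology_generated_by_Basis) blast

lemma continuous_map_evaluation: "u \<in> T \<Longrightarrow> continuous_map W euclidean (\<lambda>f. u f)"
  by (simp add: continuous_map_def topspace_weak_star openin_weak_star)

text \<open>
  The families \<open>p\<close> that are linear in their index form a closed subset of a product of compact
  balls, and each of them is evaluation at some operator, because \<open>\<alpha>\<close> is dominated by the product
  \<open>dist x y * norm e\<close> on elementary tensors. The map from families to operators is continuous
  because the weak* topology is generated by the coordinates.
\<close>

lemma compactin_polar:
  assumes \<alpha>: "\<And>x y e. \<alpha> (el x y e) \<le> dist x y * norm e"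
  shows "compactin W {f \<in> L0. \<forall>u\<in>T. norm (u f) \<le> \<alpha> u}" (is "compactin W ?K")
proof -
  define Y where "Y = product_topology (\<lambda>u. subtopology euclidean (cball (0::'k) (\<alpha> u))) T"
  have top_Y: "topspace Y = (\<Pi>\<^sub>E u\<in>T. cball 0 (\<alpha> u))"
    by (simp add: Y_def)
  have "compact_space Y"
    unfolding Y_def compact_space_product_topology
    by (simp add: compact_space_subtopology compactin_euclidean_iff compact_scalar_cball)
  have proj: "continuous_map Y euclidean (\<lambda>p. p u)" if "u \<in> T" for u
    using continuous_map_product_projection[OF that, of "\<lambda>u. subtopology euclidean (cball (0::'k) (\<alpha> u))"]
    unfolding Y_def continuous_map_in_subtopology by blast
  have mult: "continuous_map Y euclidean (\<lambda>p. c * p u)" if "u \<in> T" for u c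
    using continuous_map_compose[OF proj[OF that], of euclidean "\<lambda>x. c * x"]
    by (simp add: o_def continuous_intros)
  define A where "A u v = {p \<in> topspace Y. p (u + v) = p u + p v}" for u v
  define S where "S c u = {p \<in> topspace Y. p (scale_fun c u) = c * p u}" for c u
  define P where "P = (\<Inter>u\<in>T. \<Inter>v\<in>T. A u v) \<inter> (\<Inter>c. \<Inter>u\<in>T. S c u)"
  have "T \<noteq> {}" using T_zero by blast
  have "closedin Y (A u v)" if "u \<in> T" "v \<in> T" for u v
    unfolding A_def by (intro closedin_continuous_maps_eq[of euclidean] proj continuous_map_add T_add that) simp
  moreover have "closedin Y (S c u)" if "u \<in> T" for c u
    unfolding S_def by (intro closedin_continuous_maps_eq[of euclidean] proj mult T_scale that) simp
  ultimately have "closedin Y P"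
    unfolding P_def using \<open>T \<noteq> {}\<close> by (intro closedin_Int closedin_INT) auto
  then have "compactin Y P" using \<open>compact_space Y\<close> by (rule closedin_compact_space[rotated])
  then have compact: "compact_space (subtopology Y P)" by (rule compact_space_subtopology)
  define F where "F p = (SOME f. f \<in> L0 \<and> (\<forall>u\<in>T. u f = p u))" for p
  have P_sub: "P \<subseteq> topspace Y" using closedin_subset[OF \<open>closedin Y P\<close>] .
  have P_norm: "norm (p u) \<le> \<alpha> u" if "p \<in> P" "u \<in> T" for p u
  proof -
    have "p \<in> (\<Pi>\<^sub>E u\<in>T. cball 0 (\<alpha> u))" using that(1) P_sub top_Y by blast
    then have "p u \<in> cball 0 (\<alpha> u)" using that(2) by (rule PiE_mem)
    then show ?thesis by simp
  qed
  have F: "F p \<in> L0 \<and> (\<forall>u\<in>T. u (F p) = p u)" if p: "p \<in> P" for p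
  proof -
    have "norm (p (el x y e)) \<le> 1 * dist x y * norm e" for x y e
      using P_norm[OF p elt_in[of x y e]] \<alpha>[of x y e] by simp
    moreover have "p (u + v) = p u + p v" if "u \<in> T" "v \<in> T" for u v
      using p that unfolding P_def A_def by blast
    moreover have "p (scale_fun c u) = c * p u" if "u \<in> T" for c u
      using p that unfolding P_def S_def by blast
    ultimately obtain f where "f \<in> L0" "\<And>u. u \<in> T \<Longrightarrow> u f = p u"
      using functional_is_evaluation[of p 1] zero_le_one by blast
    then have "\<exists>f. f \<in> L0 \<and> (\<forall>u\<in>T. u f = p u)" by blast
    then show ?thesis unfolding F_def by (rule someI_ex)
  qed
  have top_P: "topspace (subtopology Y P) = P" using P_sub by auto
  have "continuous_map (subtopology Y P) W F"
    unfolding weak_star_lip_topology_def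
  proof (rule continuous_on_generated_topo)
    fix U assume "U \<in> {{f \<in> L0. u f \<in> U} |u U. u \<in> T \<and> open U}"
    then obtain u V where uV: "u \<in> T" "open V" "U = {f \<in> L0. u f \<in> V}" by blast
    have "F -` U \<inter> topspace (subtopology Y P) = {p \<in> topspace (subtopology Y P). p u \<in> V}"
    proof -
      have "F p \<in> L0 \<and> u (F p) = p u" if "p \<in> P" for p
        using F[OF that] uV(1) by blast
      then show ?thesis unfolding top_P uV(3) by auto
    qed
    then show "openin (subtopology Y P) (F -` U \<inter> topspace (subtopology Y P))"
      using openin_continuous_map_preimage[OF continuous_map_from_subtopology[OF proj[OF uV(1)]], of V P]
        uV(2) by simp
  next
    have "F p \<in> topspace W" if "p \<in> P" for p
      using F[OF that] by (simp only: topspace_weak_star)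
    then have "F ` topspace (subtopology Y P) \<subseteq> topspace W"
      unfolding top_P by (rule image_subsetI)
    then show "F ` topspace (subtopology Y P) \<subseteq> \<Union> {{f \<in> L0. u f \<in> U} |u U. u \<in> T \<and> open U}"
      by (simp only: weak_star_lip_topology_def topology_generated_by_topspace)
  qed
  then have "compactin W (F ` P)"
    by (rule image_compactin[rotated]) (use compact in \<open>simp only: compact_space_def top_P\<close>)
  moreover have "F ` P = ?K"
  proof
    have "F p \<in> ?K" if "p \<in> P" for p
    proof -
      have "norm (u (F p)) \<le> \<alpha> u" if "u \<in> T" for u
        using F[OF \<open>p \<in> P\<close>] P_norm[OF \<open>p \<in> P\<close> that] that by fastforce
      then show ?thesis using F[OF that] by blast
    qed
    then show "F ` P \<subseteq> ?K" by (rule image_subsetI)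
  next
    show "?K \<subseteq> F ` P"
    proof
      fix f assume f: "f \<in> ?K"
      define p where "p = restrict (\<lambda>u. u f) T"
      have p_top: "p \<in> topspace Y" using f by (auto simp: p_def top_Y)
      have "p u = u f" if "u \<in> T" for u
        using that by (simp add: p_def)
      moreover have "scale_fun c u f = c * u f" for c :: 'k and u
        by (simp add: scale_fun_def)
      ultimately have "p \<in> P"
        unfolding P_def A_def S_def using p_top by (simp add: T_add T_scale)
      moreover have "F p = f"
      proof (rule Lip0_eqI)
        show "u (F p) = u f" if "u \<in> T" for u
          using F[OF \<open>p \<in> P\<close>] that by (simp add: p_def)
      qed (use F[OF \<open>p \<in> P\<close>] f in auto)
      ultimately show "f \<in> F ` P" by blast
    qed
  qed
  ultimately show ?thesis by simp
qed

end

context lipschitz_tensor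
begin

section \<open>Separation from weak* compact convex sets\<close>

text \<open>
  By compactness, finitely many real functionals \<open>re \<circ> u\<close> distinguish \<open>h\<close> from every point of \<open>K\<close>.
  They map \<open>K\<close> onto a compact convex set in a Euclidean space, which has a point \<open>k0\<close> nearest to
  the image of \<open>h\<close>. The vector from \<open>k0\<close> to \<open>h\<close> then defines the separating functional, and \<open>D\<close> is
  the squared distance.
\<close>

lemma weak_star_separation:
  assumes lin: "linear re" and re: "\<And>c :: 'k. \<bar>re c\<bar> \<le> norm c" and re_real: "\<And>r. re (of_real r) = r"
    and compact: "compactin W K" and "K \<noteq> {}"
    and convex: "\<And>k l t. k \<in> K \<Longrightarrow> l \<in> K \<Longrightarrow> 0 \<le> t \<Longrightarrow> t \<le> 1 \<Longrightarrow>
      scale_op (of_real (1 - t)) k + scale_op (of_real t) l \<in> K"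
    and h: "h \<in> L0" "h \<notin> K"
  shows "\<exists>v\<in>T. \<exists>D>0. \<forall>k\<in>K. re (v k) + D \<le> re (v h)"
proof -
  have K: "K \<subseteq> L0"
    using compactin_subset_topspace[OF compact] by (simp add: topspace_weak_star)
  have cont_re: "continuous_on UNIV re"
    using lin re by (intro linear_continuous_on bounded_linear_intro[of _ 1]) (auto simp: linear_add linear_scale)
  have re_mult: "re (of_real r * c) = r * re c" for r c
    using linear_scale[OF lin, of r c] by (simp add: scaleR_conv_of_real)
  have re_diff: "re (c - d) = re c - re d" for c d
    by (rule linear_diff[OF lin])
  define G where "G u = {f \<in> L0. u f \<in> {c. re c \<noteq> re (u h)}}" for u
  have "openin W (G u)" if "u \<in> T" for u
    unfolding G_def using that
    by (rule openin_weak_star) (intro open_Collect_neq cont_re continuous_on_const)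
  moreover have "K \<subseteq> \<Union> (G ` T)"
  proof
    fix k assume k: "k \<in> K"
    then have "k \<in> L0" "k \<noteq> h" using K h by auto
    then obtain u where u: "u \<in> T" "u k \<noteq> u h"
      using Lip0_eqI[OF _ h(1)] by blast
    obtain a where a: "a * (u k - u h) = of_real (norm (u k - u h))"
      using unimodular_multiple by blast
    have "re (a * u k) - re (a * u h) = norm (u k - u h)"
      using re_real[of "norm (u k - u h)"] by (simp add: a[symmetric] right_diff_distrib re_diff)
    then have "re (a * u k) \<noteq> re (a * u h)" using u(2) by auto
    then have "k \<in> G (scale_fun a u)"
      using \<open>k \<in> L0\<close> by (simp add: G_def scale_fun_def)
    then show "k \<in> \<Union> (G ` T)" using T_scale[OF u(1)] by blast
  qed
  ultimately obtain \<F> where "finite \<F>" "\<F> \<subseteq> G ` T" "K \<subseteq> \<Union> \<F>"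
    using compactinD[OF compact, of "G ` T"] by auto
  then obtain F where F: "F \<subseteq> T" "finite F" and cover: "K \<subseteq> \<Union> (G ` F)"
    using finite_subset_image by metis
  define Q where "Q f = (\<Sum>u\<in>F. (re (u f) - re (u h))\<^sup>2)" for f
  have "continuous_map W euclideanreal (\<lambda>f. (re (u f) - re (u h))\<^sup>2)" if "u \<in> F" for u
  proof -
    have "continuous_map W euclidean ((\<lambda>c. (re c - re (u h))\<^sup>2) \<circ> (\<lambda>f. u f))"
      using F(1) that cont_re
      by (intro continuous_map_compose[OF continuous_map_evaluation[of u]])
        (auto intro!: continuous_intros)
    then show ?thesis by (simp add: o_def)
  qed
  then have "continuous_map W euclideanreal Q"
    unfolding Q_def[abs_def] using F(2) by (intro continuous_map_sum) auto
  then have "compact (Q ` K)"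
    using image_compactin[OF compact] compactin_euclidean_iff by blast
  then obtain k0 where k0: "k0 \<in> K" and min: "\<And>k. k \<in> K \<Longrightarrow> Q k0 \<le> Q k"
    using compact_attains_inf[of "Q ` K"] \<open>K \<noteq> {}\<close> by auto
  \<comment> \<open>The separating functional has the components of the vector from the nearest point to \<open>h\<close> as
      coefficients.\<close>
  define r where "r u = re (u h) - re (u k0)" for u
  define v where "v = (\<Sum>u\<in>F. scale_fun (of_real (r u)) u)"
  have v: "re (v f) = (\<Sum>u\<in>F. r u * re (u f))" for f
    unfolding v_def sum_fun_apply scale_fun_def linear_sum[OF lin] re_mult ..
  have Q0: "Q k0 = (\<Sum>u\<in>F. (r u)\<^sup>2)"
    unfolding Q_def r_def by (simp add: power2_commute)
  have "0 < Q k0"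
  proof -
    obtain u where u: "u \<in> F" "k0 \<in> G u" using cover k0 by blast
    then have "0 < (re (u k0) - re (u h))\<^sup>2" by (simp add: G_def)
    then show ?thesis unfolding Q_def using F(2) u(1) by (intro sum_pos2[of F u]) auto
  qed
  moreover have "re (v k) + Q k0 \<le> re (v h)" if k: "k \<in> K" for k
  proof -
    define s where "s u = re (u k) - re (u k0)" for u
    define R where "R = (\<Sum>u\<in>F. r u * s u)"
    define S where "S = (\<Sum>u\<in>F. (s u)\<^sup>2)"
    have "0 \<le> S" unfolding S_def by (simp add: sum_nonneg)
    \<comment> \<open>On the segment from \<open>k0\<close> to \<open>k\<close> the squared distance is a quadratic polynomial in \<open>t\<close>, smallest
        at \<open>0\<close>, so its derivative \<open>- 2 * R\<close> there is nonnegative.\<close>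
    have segment: "2 * t * R \<le> t\<^sup>2 * S" if t: "0 \<le> t" "t \<le> 1" for t
    proof -
      let ?l = "scale_op (of_real (1 - t)) k0 + scale_op (of_real t) k"
      have "re (u ?l) - re (u h) = t * s u - r u" if "u \<in> F" for u
      proof -
        have "u \<in> T" using that F(1) by blast
        have L0: "k0 \<in> L0" "k \<in> L0" using k k0 K by blast+
        have "u ?l = of_real (1 - t) * u k0 + of_real t * u k"
          unfolding tensor_linear(1)[OF \<open>u \<in> T\<close> Lip0_scale[OF L0(1)] Lip0_scale[OF L0(2)]]
            tensor_linear(2)[OF \<open>u \<in> T\<close> L0(1) L0(1)] tensor_linear(2)[OF \<open>u \<in> T\<close> L0(2) L0(2)]
          by (rule refl)
        then have "re (u ?l) = (1 - t) * re (u k0) + t * re (u k)"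
          by (simp only: linear_add[OF lin] re_mult)
        then show ?thesis by (simp add: s_def r_def algebra_simps)
      qed
      then have "Q ?l = (\<Sum>u\<in>F. (t * s u - r u)\<^sup>2)"
        unfolding Q_def by simp
      also have "\<dots> = t\<^sup>2 * S - 2 * t * R + Q k0"
        unfolding Q0 R_def S_def
        by (simp add: power2_diff power_mult_distrib sum.distrib sum_subtractf sum_distrib_left algebra_simps)
      finally show ?thesis
        using min[OF convex[OF k0 k t]] by simp
    qed
    have "R \<le> 0"
    proof (rule ccontr)
      assume "\<not> R \<le> 0"
      then have R: "0 < R" by simp
      \<comment> \<open>A parameter in \<open>(0, 1]\<close> with \<open>t * S \<le> R\<close>, also when \<open>S = 0\<close>.\<close>
      define t where "t = R / (S + R)"
      have t: "0 < t" "t \<le> 1" using R \<open>0 \<le> S\<close> by (auto simp: t_def)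
      have "t * (2 * R) \<le> t * (t * S)"
        using segment[of t] t by (simp add: power2_eq_square algebra_simps)
      then have "2 * R \<le> t * S" using t by simp
      also have "\<dots> \<le> R"
      proof -
        have "S / (S + R) \<le> 1" using R \<open>0 \<le> S\<close> by simp
        then have "R * (S / (S + R)) \<le> R * 1" using R by (intro mult_left_mono) auto
        then show ?thesis by (simp add: t_def)
      qed
      finally show False using R by simp
    qed
    moreover have "re (v h) - re (v k) = Q k0 - R"
      unfolding v Q0 R_def s_def r_def sum_subtractf[symmetric]
      by (rule sum.cong) (simp_all add: power2_eq_square algebra_simps)
    ultimately show ?thesis by linarith
  qed
  moreover have "v \<in> T"
    unfolding v_def using F(1) by (intro T_sum T_scale) auto
  ultimately show ?thesis by blast
qed

section \<open>The norm polar to the unit ball\<close>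

context
  fixes B :: "('x \<Rightarrow> 'e \<Rightarrow>\<^sub>L 'k) set" and NB :: "('x \<Rightarrow> 'e \<Rightarrow>\<^sub>L 'k) \<Rightarrow> real"
  assumes B: "lip_op_banach sE z B NB"
begin

abbreviation "K \<equiv> {f \<in> B. NB f \<le> 1}"

text \<open>
  The only candidate: if \<open>B\<close> is the dual of the completion for a norm \<open>\<alpha>\<close>, then \<open>K\<close> is the dual
  unit ball, and by the Hahn--Banach theorem \<open>\<alpha>\<close> is recovered from it by this supremum.
\<close>

definition polar_norm :: "(('x \<Rightarrow> 'e \<Rightarrow>\<^sub>L 'k) \<Rightarrow> 'k) \<Rightarrow> real" where
  "polar_norm u = (SUP f\<in>K. norm (u f))"

lemma B_Lip0: "f \<in> B \<Longrightarrow> f \<in> L0"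
  and Lip_le_NB: "f \<in> B \<Longrightarrow> Lip f \<le> NB f"
  and rank_one_in: "g \<in> lip_dual z \<Longrightarrow> \<phi> \<in> dualE sE \<Longrightarrow> (\<lambda>x. scaleD (g x) \<phi>) \<in> B"
  and NB_rank_one: "g \<in> lip_dual z \<Longrightarrow> \<phi> \<in> dualE sE \<Longrightarrow> NB (\<lambda>x. scaleD (g x) \<phi>) = Lip g * norm \<phi>"
  using B unfolding lip_op_banach_def by auto

lemma normed_subspace_B: "normed_subspace scale_op B NB"
  unfolding normed_subspace_def normed_subspace_axioms_def
  using B vector_space_scale_op by (auto simp: lip_op_banach_def)

interpretation NB: normed_subspace scale_op B NB
  by (rule normed_subspace_B)

lemma norm_elt_le:
  assumes "f \<in> K"
  shows "norm (el x y e f) \<le> dist x y * norm e"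
proof -
  have f: "f \<in> B" "NB f \<le> 1" using assms by auto
  have "f \<in> L0" by (rule B_Lip0[OF f(1)])
  then obtain L where "L-lipschitz_on UNIV f" by (auto simp: Lip0_def)
  then have "norm (f x - f y) \<le> Lip f * dist x y"
    using lipschitz_onD[OF lipschitz_on_Lip, of L f x y] by (simp add: dist_norm)
  also have "\<dots> \<le> 1 * dist x y"
    using Lip_le_NB[OF f(1)] f(2) by (intro mult_right_mono) auto
  finally have "norm (f x - f y) * norm e \<le> dist x y * norm e"
    by (intro mult_right_mono) auto
  then show ?thesis
    using norm_blinfun[of "f x - f y" e] \<open>f \<in> L0\<close> by (simp add: elt_apply blinfun.diff_left)
qed

lemma zero_in_K: "0 \<in> K"
  using NB.V_zero NB.N_zero by simp

text \<open>
  Finiteness of the supremum reduces to elementary tensors, on which it is the estimate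
  \<open>Lip f \<le> NB f\<close>.
\<close>

lemma bdd_above_evaluation:
  assumes "u \<in> T"
  shows "bdd_above ((\<lambda>f. norm (u f)) ` K)"
proof -
  have "\<exists>M. \<forall>f\<in>K. norm (u f) \<le> M"
    using assms
  proof (induction rule: tensor_induct)
    case zero
    show ?case by (intro exI[of _ 0]) simp
  next
    case (step c x y e u)
    then obtain M where M: "\<And>f. f \<in> K \<Longrightarrow> norm (u f) \<le> M" by blast
    have "norm (el x y (sE c e) f + u f) \<le> dist x y * norm (sE c e) + M" if "f \<in> K" for f
      by (rule norm_triangle_mono[OF norm_elt_le[OF that] M[OF that]])
    then show ?case by (intro exI[of _ "dist x y * norm (sE c e) + M"]) simp
  qed
  then show ?thesis by (auto simp: bdd_above_def)
qed

lemma polar_norm_upper: "u \<in> T \<Longrightarrow> f \<in> K \<Longrightarrow> norm (u f) \<le> polar_norm u"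
  unfolding polar_norm_def by (rule cSUP_upper[OF _ bdd_above_evaluation])

lemma polar_norm_least: "(\<And>f. f \<in> K \<Longrightarrow> norm (u f) \<le> M) \<Longrightarrow> polar_norm u \<le> M"
  unfolding polar_norm_def using zero_in_K by (intro cSUP_least) auto

lemma polar_norm_nonneg: "u \<in> T \<Longrightarrow> 0 \<le> polar_norm u"
  using polar_norm_upper[OF _ zero_in_K] norm_ge_zero order_trans by blast

lemma normalised_in_K:
  assumes "f \<in> B" "NB f \<noteq> 0"
  shows "scale_op (of_real (inverse (NB f))) f \<in> K"
  using assms NB.N_nonneg[OF assms(1)] by (simp add: NB.V_scale NB.N_scale norm_inverse)

lemma polar_norm_bound:
  assumes "u \<in> T" "f \<in> B"
  shows "norm (u f) \<le> NB f * polar_norm u"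
proof (cases "NB f = 0")
  case True
  then have "f = 0" using NB.N_zero_iff[OF assms(2)] by simp
  then have "u f = 0"
    using tensor_linear(2)[OF assms(1) B_Lip0[OF NB.V_zero] B_Lip0[OF NB.V_zero], of 0] by simp
  then show ?thesis using True by simp
next
  case False
  then have "norm (u (scale_op (of_real (inverse (NB f))) f)) \<le> polar_norm u"
    by (rule polar_norm_upper[OF assms(1) normalised_in_K[OF assms(2)]])
  moreover have "0 < NB f" using False NB.N_nonneg[OF assms(2)] by simp
  ultimately show ?thesis
    using B_Lip0[OF assms(2)] assms(1)
    by (simp add: tensor_linear(2)[where g=f] norm_mult norm_inverse norm_divide field_simps)
qed

lemma polar_norm_cross: "polar_norm (el x y e) = dist x y * norm e"
proof (rule antisym)
  show "polar_norm (el x y e) \<le> dist x y * norm e"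
    by (rule polar_norm_least) (rule norm_elt_le)
  obtain g and \<phi> :: "'e \<Rightarrow>\<^sub>L 'k" where g: "g \<in> lip_dual z" "\<phi> \<in> dualE sE" "Lip g * norm \<phi> \<le> 1"
    and eq: "el x y e (\<lambda>w. scaleD (g w) \<phi>) = of_real (dist x y * norm e)"
    using rank_one_norming .
  have "(\<lambda>w. scaleD (g w) \<phi>) \<in> K"
    using g by (simp add: rank_one_in NB_rank_one)
  then have "norm (el x y e (\<lambda>w. scaleD (g w) \<phi>)) \<le> polar_norm (el x y e)"
    by (rule polar_norm_upper[OF elt_in])
  then show "dist x y * norm e \<le> polar_norm (el x y e)"
    unfolding eq norm_of_real by linarith
qed

text \<open>
  Definiteness holds because \<open>B\<close> contains all rank-one operators, which separate the tensor
  product.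
\<close>

lemma lip_cross_norm_polar_norm: "lip_cross_norm sE z polar_norm"
  unfolding lip_cross_norm_def norm_on_def
proof (intro conjI ballI allI)
  fix u assume u: "u \<in> T"
  show "0 \<le> polar_norm u" by (rule polar_norm_nonneg[OF u])
  show "polar_norm u = 0 \<longleftrightarrow> u = 0"
  proof
    assume 0: "polar_norm u = 0"
    show "u = 0"
      using u
    proof (rule rank_one_separates)
      fix g :: "'x \<Rightarrow> 'k" and \<phi> :: "'e \<Rightarrow>\<^sub>L 'k" assume "g \<in> lip_dual z" "\<phi> \<in> dualE sE"
      then show "u (\<lambda>x. scaleD (g x) \<phi>) = 0"
        using polar_norm_bound[OF u rank_one_in] 0 by simp
    qed
  next
    assume "u = 0"
    then have "polar_norm u \<le> 0" by (intro polar_norm_least) simp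
    then show "polar_norm u = 0" using polar_norm_nonneg[OF u] by simp
  qed
next
  have le: "polar_norm (scale_fun c u) \<le> norm c * polar_norm u" if "u \<in> T" for c u
    by (rule polar_norm_least)
      (simp add: scale_fun_def norm_mult mult_left_mono polar_norm_upper that)
  fix c u assume u: "u \<in> T"
  show "polar_norm (scale_fun c u) = norm c * polar_norm u"
  proof (cases "c = 0")
    case True
    have "polar_norm (scale_fun c u) \<le> 0" using le[OF u, of c] True by simp
    then show ?thesis using polar_norm_nonneg[OF T_scale[OF u, of c]] True by simp
  next
    case False
    have "u = scale_fun (inverse c) (scale_fun c u)" using False by (simp add: scale_fun_def fun_eq_iff)
    then have "polar_norm u \<le> inverse (norm c) * polar_norm (scale_fun c u)"
      using le[OF T_scale[OF u], of "inverse c" c] by (simp add: norm_inverse)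
    then have "norm c * polar_norm u \<le> polar_norm (scale_fun c u)"
      using False by (simp add: field_simps)
    then show ?thesis using le[OF u, of c] by simp
  qed
next
  fix u v assume "u \<in> T" "v \<in> T"
  then show "polar_norm (u + v) \<le> polar_norm u + polar_norm v"
    by (intro polar_norm_least) (simp add: norm_triangle_mono polar_norm_upper)
qed (rule subspace_T, rule polar_norm_cross)

lemma dualizable_polar_norm: "dualizable sE z polar_norm"
  unfolding dualizable_def
proof (intro ballI allI)
  fix g :: "'x \<Rightarrow> 'k" and \<phi> :: "'e \<Rightarrow>\<^sub>L 'k" and n :: nat and x y e
  assume g: "g \<in> lip_dual z" "\<phi> \<in> dualE sE"
  have "(\<Sum>i<n. el (x i) (y i) (e i)) \<in> T" by (intro T_sum elt_in)
  from polar_norm_bound[OF this rank_one_in[OF g]]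
  show "norm (\<Sum>i<n. (g (x i) - g (y i)) * blinfun_apply \<phi> (e i))
      \<le> Lip g * norm \<phi> * polar_norm (\<Sum>i<n. el (x i) (y i) (e i))"
    by (simp only: sum_elt_rank_one[OF g] NB_rank_one[OF g])
qed

text \<open>
  The unit ball is convex and balanced; balancedness turns the separation of real parts into a
  separation of absolute values, which contradicts the definition of \<open>polar_norm\<close>.
\<close>

lemma bipolar:
  assumes compact: "compactin W K" and h: "h \<in> L0" and le: "\<And>u. u \<in> T \<Longrightarrow> norm (u h) \<le> polar_norm u"
  shows "h \<in> K"
proof (rule ccontr)
  assume "h \<notin> K"
  obtain \<iota> :: 'k and re where lin: "linear re" and re: "\<And>c. \<bar>re c\<bar> \<le> norm c"
    and re_eq: "\<And>a b. re (a *\<^sub>R 1 + b *\<^sub>R \<iota>) = a"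
    using scalar_decomposition[where 'k = 'k] by metis
  have re_real: "re (of_real r) = r" for r
    using re_eq[of r 0] by (simp add: of_real_def)
  have convex: "scale_op (of_real (1 - t)) k + scale_op (of_real t) l \<in> K"
    if kl: "k \<in> K" "l \<in> K" and t: "0 \<le> t" "t \<le> 1" for k l and t :: real
  proof -
    have in_B: "scale_op (of_real (1 - t)) k \<in> B" "scale_op (of_real t) l \<in> B"
      using kl by (auto intro: NB.V_scale)
    have "NB (scale_op (of_real (1 - t)) k) = (1 - t) * NB k" "NB (scale_op (of_real t) l) = t * NB l"
      using kl t by (auto simp only: NB.N_scale norm_of_real abs_of_nonneg mem_Collect_eq diff_ge_0_iff_ge)
    then have "NB (scale_op (of_real (1 - t)) k + scale_op (of_real t) l) \<le> (1 - t) * NB k + t * NB l"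
      using NB.N_add[OF in_B] by simp
    also have "\<dots> \<le> 1" using kl t by (intro convex_bound_le) auto
    finally show ?thesis using NB.V_add[OF in_B] by blast
  qed
  have "K \<noteq> {}" using zero_in_K by blast
  have "\<exists>v\<in>T. \<exists>D>0. \<forall>k\<in>K. re (v k) + D \<le> re (v h)"
    by (rule weak_star_separation[OF lin re re_real compact \<open>K \<noteq> {}\<close> convex h \<open>h \<notin> K\<close>])
  then obtain v D where v: "v \<in> T" and "0 < D" and sep: "\<forall>k\<in>K. re (v k) + D \<le> re (v h)"
    by blast
  have "norm (v k) \<le> re (v h) - D" if k: "k \<in> K" for k
  proof -
    obtain a where a: "norm a = 1" "a * v k = of_real (norm (v k))"
      using unimodular_multiple by blast
    have "scale_op a k \<in> K"
      using k by (simp add: NB.V_scale NB.N_scale a(1))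
    then have "re (v (scale_op a k)) + D \<le> re (v h)" by (rule sep[rule_format])
    moreover have "v (scale_op a k) = of_real (norm (v k))"
      using k B_Lip0 by (simp add: tensor_linear(2)[OF v, where g=k] a(2))
    ultimately show ?thesis by (simp add: re_real)
  qed
  then have "polar_norm v \<le> re (v h) - D" by (rule polar_norm_least)
  also have "\<dots> < norm (v h)" using \<open>0 < D\<close> re[of "v h"] by linarith
  finally show False using le[OF v] by simp
qed

text \<open>
  Scaling by an admissible constant \<open>C > 0\<close> moves an \<open>\<alpha>\<close>-Lipschitz operator into the polar of
  \<open>polar_norm\<close>, which is the unit ball of \<open>B\<close>; hence \<open>NB f\<close> is the smallest admissible constant.
\<close>

lemma Lip_alpha_polar_norm:
  assumes compact: "compactin W K"
  shows "B = Lip_alpha_space sE z polar_norm \<and> (\<forall>f\<in>B. NB f = Lip_alpha sE z polar_norm f)"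
proof -
  note cross = lip_cross_norm_polar_norm
  have bound: "alpha_bound sE z polar_norm f (NB f)" if "f \<in> B" for f
    using that by (simp add: alpha_bound_iff[OF B_Lip0] NB.N_nonneg polar_norm_bound)
  have converse: "f \<in> B \<and> NB f \<le> C" if f: "f \<in> L0" and C: "alpha_bound sE z polar_norm f C" for f C
  proof (cases "C = 0")
    case True
    have "f = 0"
    proof (rule Lip0_eqI[OF f B_Lip0[OF NB.V_zero]])
      fix u assume u: "u \<in> T"
      have "u f = 0" using C u True by (simp add: alpha_bound_iff[OF f])
      moreover have "u 0 = 0"
        using polar_norm_bound[OF u NB.V_zero] by (simp add: NB.N_zero)
      ultimately show "u f = u 0" by simp
    qed
    then show ?thesis using True NB.V_zero NB.N_zero by simp
  next
    case False
    then have pos: "0 < C" using C by (simp add: alpha_bound_def)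
    let ?h = "scale_op (of_real (inverse C)) f"
    have h: "?h \<in> K"
    proof (rule bipolar[OF compact Lip0_scale[OF f]])
      fix u assume u: "u \<in> T"
      then have "norm (u f) \<le> C * polar_norm u" using C by (simp add: alpha_bound_iff[OF f])
      then show "norm (u ?h) \<le> polar_norm u"
        using pos by (simp add: tensor_linear(2)[OF u f f] norm_mult norm_inverse norm_divide field_simps)
    qed
    have f_eq: "f = scale_op (of_real C) ?h"
      using pos by (simp only: NB.scale_scale of_real_mult[symmetric]) simp
    have "f \<in> B" using h NB.V_scale[of ?h "of_real C"] f_eq by simp
    moreover have "NB f = C * NB ?h"
      using NB.N_scale[of ?h "of_real C"] h f_eq pos by simp
    moreover have "C * NB ?h \<le> C * 1" using h pos by (intro mult_left_mono) auto
    ultimately show ?thesis by simp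
  qed
  have "B = Lip_alpha_space sE z polar_norm"
    using bound converse B_Lip0 unfolding Lip_alpha_space_iff[OF cross] set_eq_iff by blast
  moreover have "NB f = Lip_alpha sE z polar_norm f" if "f \<in> B" for f
    unfolding Lip_alpha_def
    using bound[OF that] converse[OF B_Lip0[OF that]] by (intro cInf_eq_minimum[symmetric]) auto
  ultimately show ?thesis by blast
qed

end

end

section \<open>The three characterisations\<close>

theorem corollary6p6:
  fixes sE :: "'k::real_or_complex \<Rightarrow> 'e::banach \<Rightarrow> 'e"
    and z :: "'x::metric_space"
    and B :: "('x \<Rightarrow> 'e \<Rightarrow>\<^sub>L 'k) set"
    and NB :: "('x \<Rightarrow> 'e \<Rightarrow>\<^sub>L 'k) \<Rightarrow> real"
  assumes "scalar_banach sE"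
    and "lip_op_banach sE z B NB"
  shows "((\<exists>\<alpha>. lip_cross_norm sE z \<alpha> \<and> dualizable sE z \<alpha> \<and>
                B = Lip_alpha_space sE z \<alpha> \<and> (\<forall>f\<in>B. NB f = Lip_alpha sE z \<alpha> f))
          \<longleftrightarrow>
          (\<exists>\<alpha>. lip_cross_norm sE z \<alpha> \<and> dualizable sE z \<alpha> \<and>
                (\<exists>J. canonical_iso sE z \<alpha> B NB J)))
       \<and>
         ((\<exists>\<alpha>. lip_cross_norm sE z \<alpha> \<and> dualizable sE z \<alpha> \<and>
                (\<exists>J. canonical_iso sE z \<alpha> B NB J))
          \<longleftrightarrow>
          compactin (weak_star_lip_topology sE z) {f \<in> B. NB f \<le> 1})"
proof -
  interpret lipschitz_tensor sE z
    using assms(1) by (simp add: lipschitz_tensor_def)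
  have "B \<subseteq> L0" using assms(2) by (simp add: lip_op_banach_def)
  have iso: "(\<exists>J. canonical_iso sE z \<alpha> B NB J)
      \<longleftrightarrow> B = Lip_alpha_space sE z \<alpha> \<and> (\<forall>f\<in>B. NB f = Lip_alpha sE z \<alpha> f)"
    if \<alpha>: "lip_cross_norm sE z \<alpha>" for \<alpha>
  proof
    assume "\<exists>J. canonical_iso sE z \<alpha> B NB J"
    then show "B = Lip_alpha_space sE z \<alpha> \<and> (\<forall>f\<in>B. NB f = Lip_alpha sE z \<alpha> f)"
      using canonical_iso_determines[OF \<alpha> \<open>B \<subseteq> L0\<close>] by blast
  next
    assume eq: "B = Lip_alpha_space sE z \<alpha> \<and> (\<forall>f\<in>B. NB f = Lip_alpha sE z \<alpha> f)"
    obtain J where "canonical_iso sE z \<alpha> B (Lip_alpha sE z \<alpha>) J"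
      using canonical_iso_Lip_alpha[OF \<alpha>] eq by metis
    then have "canonical_iso sE z \<alpha> B NB J"
      using eq unfolding canonical_iso_def by simp
    then show "\<exists>J. canonical_iso sE z \<alpha> B NB J" by blast
  qed
  have compact: "compactin W {f \<in> B. NB f \<le> 1}"
    if \<alpha>: "lip_cross_norm sE z \<alpha>"
      and eq: "B = Lip_alpha_space sE z \<alpha>" "\<forall>f\<in>B. NB f = Lip_alpha sE z \<alpha> f" for \<alpha>
  proof -
    have "{f \<in> B. NB f \<le> 1} = {f. f \<in> Lip_alpha_space sE z \<alpha> \<and> Lip_alpha sE z \<alpha> f \<le> 1}"
      using eq by auto
    then have "{f \<in> B. NB f \<le> 1} = {f \<in> L0. \<forall>u\<in>T. norm (u f) \<le> \<alpha> u}"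
      by (simp only: Lip_alpha_le_one_iff[OF \<alpha>])
    moreover have "\<alpha> (el x y e) \<le> dist x y * norm e" for x y e
      using \<alpha> by (simp add: lip_cross_norm_def)
    ultimately show ?thesis by (simp add: compactin_polar)
  qed
  let ?i = "\<exists>\<alpha>. lip_cross_norm sE z \<alpha> \<and> dualizable sE z \<alpha> \<and>
      B = Lip_alpha_space sE z \<alpha> \<and> (\<forall>f\<in>B. NB f = Lip_alpha sE z \<alpha> f)"
  let ?ii = "\<exists>\<alpha>. lip_cross_norm sE z \<alpha> \<and> dualizable sE z \<alpha> \<and> (\<exists>J. canonical_iso sE z \<alpha> B NB J)"
  have "?i \<longleftrightarrow> ?ii"
    by (simp only: iso cong: conj_cong)
  moreover have "?i \<longleftrightarrow> compactin W {f \<in> B. NB f \<le> 1}"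
  proof
    assume ?i
    then show "compactin W {f \<in> B. NB f \<le> 1}" by (elim exE conjE) (rule compact)
  next
    assume "compactin W {f \<in> B. NB f \<le> 1}"
    note Lip_alpha_polar_norm[OF assms(2) this]
    with lip_cross_norm_polar_norm[OF assms(2)] dualizable_polar_norm[OF assms(2)]
    show ?i by (intro exI conjI) (assumption | elim conjE)+
  qed
  ultimately show ?thesis by (simp only: simp_thms)
qed

end
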